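(* Let $T$ be a locally finite rooted tree and $\ell$ a length function on $T$ such that the random walk $RW(T,\ell)$ is transient. Let $\eta$ be the unit current flow on $T$ and $\mu_{\mathrm{har}}$ the corresponding harmonic measure on $\partial T$. Assume that $(T,\ell)$ is weakly complete. Then: (1) every factorial-determining sequence $\rho_0,\rho_1,\dots$ of $(T,\ell)$ is equidistributed with respect to $\mu_{\mathrm{har}}$, i.e. the measures $\frac1n\sum_{j=0}^{n-1}\delta_{\rho_j}$ converge weakly to $\mu_{\mathrm{har}}$ as $n\to\infty$; (2) $H(T,\ell)=\|\eta\|^2$, where $H(T,\ell)=\lim_{n\to\infty}\frac1n n!_{(T,\ell)}$ and $\|\eta\|^2$ is the energy of $\eta$.
   Context: $T$ has root $\mathfrak r$ and edges oriented away from the root; $v^-$ denotes the parent of $v\ne\mathfrak r$; $E(T)$ is the set of oriented edges $v^-v$. A length function is $\ell:E(T)\to\mathbb R_{+}$ with (strictly) positive values. A vertex is branching if it has at least two children; a leaf is a vertex $\neq\mathfrak r$ of valence one. $\partial T$ is the set of infinite oriented paths from $\mathfrak r$; $\widetilde\partial T$ is the union of $\partial T$ and the set of oriented paths from $\mathfrak r$ to a leaf. The topology on $\widetilde\partial T$ (and $\partial T$) has as basis the sets $B_v$ of elements passing through the vertex $v$. A measure on $\partial T$ is viewed as a measure on $\widetilde\partial T$ giving mass zero to $\widetilde\partial T\setminus\partial T$; weak convergence is on $\widetilde\partial T$. Factorials: for distinct $\rho,\tau\in\widetilde\partial T$, $\langle\rho,\tau\rangle$ is the sum of $\ell(e)$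 over common edges. Choose $\rho_0\in\widetilde\partial T$ arbitrarily; given $\rho_0,\dots,\rho_{n-1}$ choose $\rho_n\in\widetilde\partial T\setminus\{\rho_0,\dots,\rho_{n-1}\}$ minimizing $\sum_{j<n}\langle\rho,\rho_j\rangle$. Any sequence $(\rho_n)$ so obtained is called factorial-determining, and $n!_{(T,\ell)}:=\sum_{j<n}\langle\rho_n,\rho_j\rangle$ (independent of choices). Random walk: with $c(u,v)=c(v,u)=1/\ell(uv)$, $RW(T,\ell)$ starts at $\mathfrak r$ and has transition probabilities $p_{uv}=c(u,v)/\sum_{w\sim u}c(u,w)$; it is transient if almost surely it returns to $\mathfrak r$ only finitely often. Flows: a unit flow is $\theta:E(T)\to\mathbb R_{\ge0}$ with $\theta(v^-v)=\sum_{vu\in E(T)}\theta(vu)$ for all $v\ne\mathfrak r$ and $\sum_{\mathfrak r v\in E(T)}\theta(\mathfrak rv)=1$. Its energy is $\|\theta\|^2=\sum_e\ell(e)\theta(e)^2$. When $RW(T,\ell)$ is transient, unit flows of finite energy exist, and there is a unique one $\eta$ of minimum energy, the unit current flow. The harmonic measure $\mu_{\mathrm{har}}$ is the Borel probability measure on $\partial T$ with $\mu_{\mathrm{har}}(B_v\cap\partial T)=\eta(v^-v)$ for all $v\neq\mathfrak r$. Weakly complete: for every vertex $v$, every infinite oriented path starting at $v$ none of whose vertices other than $v$ is branching has infinite total $\ell$-length. *)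

theory Defs
  imports "HOL-Probability.Probability"
begin

text \<open>
  A rooted tree is given by its vertices, its edges oriented away from the root
  (\<open>(u, v)\<close> is an edge iff \<open>u\<close> is the parent of \<open>v\<close>), and its root.
\<close>

record 'v rooted_graph =
  tverts :: "'v set"
  tedges :: "('v \<times> 'v) set"
  troot :: 'v

definition rooted_tree :: "'v rooted_graph \<Rightarrow> bool" where
  "rooted_tree T \<longleftrightarrow>
     tedges T \<subseteq> tverts T \<times> tverts T \<and>
     troot T \<in> tverts T \<and>
     (\<forall>u. (u, troot T) \<notin> tedges T) \<and>
     (\<forall>v\<in>tverts T - {troot T}. \<exists>!u. (u, v) \<in> tedges T) \<and>
     (\<forall>v\<in>tverts T. (troot T, v) \<in> (tedges T)\<^sup>*)"

definition children :: "'v rooted_graph \<Rightarrow> 'v \<Rightarrow> 'v set" where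
  "children T v = {u. (v, u) \<in> tedges T}"

definition neighbours :: "'v rooted_graph \<Rightarrow> 'v \<Rightarrow> 'v set" where
  "neighbours T v = {u. (u, v) \<in> tedges T \<or> (v, u) \<in> tedges T}"

definition tree_locally_finite :: "'v rooted_graph \<Rightarrow> bool" where
  "tree_locally_finite T \<longleftrightarrow> (\<forall>v\<in>tverts T. finite (neighbours T v))"

definition branching :: "'v rooted_graph \<Rightarrow> 'v \<Rightarrow> bool" where
  "branching T v \<longleftrightarrow> (\<exists>a\<in>children T v. \<exists>b\<in>children T v. a \<noteq> b)"

definition leaf :: "'v rooted_graph \<Rightarrow> 'v \<Rightarrow> bool" where
  "leaf T v \<longleftrightarrow> v \<in> tverts T \<and> v \<noteq> troot T \<and> card (neighbours T v) = 1"

definition length_function :: "'v rooted_graph \<Rightarrow> ('v \<times> 'v \<Rightarrow> real) \<Rightarrow> bool" where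
  "length_function T l \<longleftrightarrow> (\<forall>e\<in>tedges T. 0 < l e)"

definition weakly_complete :: "'v rooted_graph \<Rightarrow> ('v \<times> 'v \<Rightarrow> real) \<Rightarrow> bool" where
  "weakly_complete T l \<longleftrightarrow>
     (\<forall>v\<in>tverts T. \<forall>f :: nat \<Rightarrow> 'v.
        f 0 = v \<longrightarrow> (\<forall>n. (f n, f (Suc n)) \<in> tedges T) \<longrightarrow> (\<forall>n\<ge>1. \<not> branching T (f n)) \<longrightarrow>
        \<not> summable (\<lambda>n. l (f n, f (Suc n))))"

datatype 'v tpath = FinPath "'v list" | InfPath "nat \<Rightarrow> 'v"

fun path_verts :: "'v tpath \<Rightarrow> 'v set" where
  "path_verts (FinPath xs) = set xs"
| "path_verts (InfPath f) = range f"

fun path_edges :: "'v tpath \<Rightarrow> ('v \<times> 'v) set" where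
  "path_edges (FinPath xs) = set (zip xs (tl xs))"
| "path_edges (InfPath f) = range (\<lambda>n. (f n, f (Suc n)))"

definition boundary :: "'v rooted_graph \<Rightarrow> 'v tpath set" where
  "boundary T = {InfPath f |f. f 0 = troot T \<and> (\<forall>n. (f n, f (Suc n)) \<in> tedges T)}"

definition leaf_paths :: "'v rooted_graph \<Rightarrow> 'v tpath set" where
  "leaf_paths T = {FinPath xs |xs. xs \<noteq> [] \<and> hd xs = troot T \<and>
     successively (\<lambda>u v. (u, v) \<in> tedges T) xs \<and> leaf T (last xs)}"

definition ext_boundary :: "'v rooted_graph \<Rightarrow> 'v tpath set" where
  "ext_boundary T = boundary T \<union> leaf_paths T"

definition through :: "'v rooted_graph \<Rightarrow> 'v \<Rightarrow> 'v tpath set" where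
  "through T v = {\<rho> \<in> ext_boundary T. v \<in> path_verts \<rho>}"

text \<open>
  Two sets \<open>through T u\<close>, \<open>through T v\<close> are nested or disjoint, and the one at the root is the
  whole space, so they form a basis of the topology they generate.
\<close>

definition ext_boundary_topology :: "'v rooted_graph \<Rightarrow> 'v tpath topology" where
  "ext_boundary_topology T = topology_generated_by (through T ` tverts T)"

definition boundary_topology :: "'v rooted_graph \<Rightarrow> 'v tpath topology" where
  "boundary_topology T = subtopology (ext_boundary_topology T) (boundary T)"

definition borel_of_top :: "'a topology \<Rightarrow> 'a measure" where
  "borel_of_top X = sigma (topspace X) {U. openin X U}"

definition weak_conv_top :: "'a topology \<Rightarrow> (nat \<Rightarrow> 'a measure) \<Rightarrow> 'a measure \<Rightarrow> bool" where
  "weak_conv_top X N M \<longleftrightarrow>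
     (\<forall>f. continuous_map X euclideanreal f \<and> bounded (f ` topspace X) \<longrightarrow>
        (\<lambda>n. \<integral>x. f x \<partial>N n) \<longlonglongrightarrow> (\<integral>x. f x \<partial>M))"

definition empirical_measure :: "'a topology \<Rightarrow> (nat \<Rightarrow> 'a) \<Rightarrow> nat \<Rightarrow> 'a measure" where
  "empirical_measure X \<rho> n =
     measure_of (topspace X) (sets (borel_of_top X))
       (\<lambda>A. (\<Sum>j<n. emeasure (return (borel_of_top X) (\<rho> j)) A) / of_nat n)"

text \<open>
  A measure on the boundary is viewed as a measure on the extended boundary by pushing it
  forward along the inclusion.
\<close>

definition extend_measure_boundary :: "'v rooted_graph \<Rightarrow> 'v tpath measure \<Rightarrow> 'v tpath measure" where
  "extend_measure_boundary T \<mu> = distr \<mu> (borel_of_top (ext_boundary_topology T)) (\<lambda>x. x)"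

definition equidistributed ::
    "'v rooted_graph \<Rightarrow> (nat \<Rightarrow> 'v tpath) \<Rightarrow> 'v tpath measure \<Rightarrow> bool" where
  "equidistributed T \<rho> \<mu> \<longleftrightarrow>
     weak_conv_top (ext_boundary_topology T)
       (empirical_measure (ext_boundary_topology T) \<rho>) (extend_measure_boundary T \<mu>)"

definition pairing :: "('v \<times> 'v \<Rightarrow> real) \<Rightarrow> 'v tpath \<Rightarrow> 'v tpath \<Rightarrow> real" where
  "pairing l \<rho> \<tau> = (\<Sum>e\<in>path_edges \<rho> \<inter> path_edges \<tau>. l e)"

definition factorial_determining ::
    "'v rooted_graph \<Rightarrow> ('v \<times> 'v \<Rightarrow> real) \<Rightarrow> (nat \<Rightarrow> 'v tpath) \<Rightarrow> bool" where
  "factorial_determining T l \<rho> \<longleftrightarrow>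
     (\<forall>n. \<rho> n \<in> ext_boundary T - \<rho> ` {..<n} \<and>
          (\<forall>\<sigma>\<in>ext_boundary T - \<rho> ` {..<n}.
             (\<Sum>j<n. pairing l (\<rho> n) (\<rho> j)) \<le> (\<Sum>j<n. pairing l \<sigma> (\<rho> j))))"

text \<open>
  The factorial does not depend on the factorial-determining sequence; the definition picks
  one sequence and uses it for all \<open>n\<close>.
\<close>

definition tree_factorial :: "'v rooted_graph \<Rightarrow> ('v \<times> 'v \<Rightarrow> real) \<Rightarrow> nat \<Rightarrow> real" where
  "tree_factorial T l n =
     (let \<rho> = (SOME \<rho>. factorial_determining T l \<rho>) in \<Sum>j<n. pairing l (\<rho> n) (\<rho> j))"

definition tree_H :: "'v rooted_graph \<Rightarrow> ('v \<times> 'v \<Rightarrow> real) \<Rightarrow> real" where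
  "tree_H T l = lim (\<lambda>n. tree_factorial T l n / real n)"

definition conductance :: "'v rooted_graph \<Rightarrow> ('v \<times> 'v \<Rightarrow> real) \<Rightarrow> 'v \<Rightarrow> 'v \<Rightarrow> real" where
  "conductance T l u v =
     (if (u, v) \<in> tedges T then 1 / l (u, v)
      else if (v, u) \<in> tedges T then 1 / l (v, u) else 0)"

definition trans_prob :: "'v rooted_graph \<Rightarrow> ('v \<times> 'v \<Rightarrow> real) \<Rightarrow> 'v \<Rightarrow> 'v \<Rightarrow> real" where
  "trans_prob T l u v = conductance T l u v / (\<Sum>w\<in>neighbours T u. conductance T l u w)"

text \<open>
  \<open>M\<close> is the law, on the space of vertex sequences, of the Markov chain started at the root with
  transition probabilities \<open>trans_prob T l\<close>. The cylinder probabilities determine it uniquely.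
\<close>

definition random_walk_law ::
    "'v rooted_graph \<Rightarrow> ('v \<times> 'v \<Rightarrow> real) \<Rightarrow> (nat \<Rightarrow> 'v) measure \<Rightarrow> bool" where
  "random_walk_law T l M \<longleftrightarrow>
     prob_space M \<and>
     sets M = sets (Pi\<^sub>M UNIV (\<lambda>_. count_space (tverts T))) \<and>
     (\<forall>n. \<forall>x :: nat \<Rightarrow> 'v. (\<forall>i\<le>n. x i \<in> tverts T) \<longrightarrow>
        measure M {\<omega> \<in> space M. \<forall>i\<le>n. \<omega> i = x i} =
          (if x 0 = troot T then \<Prod>i<n. trans_prob T l (x i) (x (Suc i)) else 0))"

definition random_walk_transient :: "'v rooted_graph \<Rightarrow> ('v \<times> 'v \<Rightarrow> real) \<Rightarrow> bool" where
  "random_walk_transient T l \<longleftrightarrow>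
     (\<exists>M. random_walk_law T l M \<and> (AE \<omega> in M. finite {n. \<omega> n = troot T}))"

definition unit_flow :: "'v rooted_graph \<Rightarrow> ('v \<times> 'v \<Rightarrow> real) \<Rightarrow> bool" where
  "unit_flow T \<theta> \<longleftrightarrow>
     (\<forall>e\<in>tedges T. 0 \<le> \<theta> e) \<and>
     (\<forall>(u, v)\<in>tedges T. \<theta> (u, v) = (\<Sum>w\<in>children T v. \<theta> (v, w))) \<and>
     (\<Sum>v\<in>children T (troot T). \<theta> (troot T, v)) = 1"

definition finite_energy ::
    "'v rooted_graph \<Rightarrow> ('v \<times> 'v \<Rightarrow> real) \<Rightarrow> ('v \<times> 'v \<Rightarrow> real) \<Rightarrow> bool" where
  "finite_energy T l \<theta> \<longleftrightarrow> (\<lambda>e. l e * (\<theta> e)\<^sup>2) summable_on tedges T"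

definition energy :: "'v rooted_graph \<Rightarrow> ('v \<times> 'v \<Rightarrow> real) \<Rightarrow> ('v \<times> 'v \<Rightarrow> real) \<Rightarrow> real" where
  "energy T l \<theta> = (\<Sum>\<^sub>\<infinity>e\<in>tedges T. l e * (\<theta> e)\<^sup>2)"

definition unit_current_flow ::
    "'v rooted_graph \<Rightarrow> ('v \<times> 'v \<Rightarrow> real) \<Rightarrow> ('v \<times> 'v \<Rightarrow> real) \<Rightarrow> bool" where
  "unit_current_flow T l \<eta> \<longleftrightarrow>
     unit_flow T \<eta> \<and> finite_energy T l \<eta> \<and>
     (\<forall>\<theta>. unit_flow T \<theta> \<and> finite_energy T l \<theta> \<longrightarrow> energy T l \<eta> \<le> energy T l \<theta>)"

definition harmonic_measure ::
    "'v rooted_graph \<Rightarrow> ('v \<times> 'v \<Rightarrow> real) \<Rightarrow> 'v tpath measure \<Rightarrow> bool" where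
  "harmonic_measure T \<eta> \<mu> \<longleftrightarrow>
     prob_space \<mu> \<and>
     space \<mu> = boundary T \<and>
     sets \<mu> = sets (borel_of_top (boundary_topology T)) \<and>
     (\<forall>(u, v)\<in>tedges T. measure \<mu> (through T v \<inter> boundary T) = \<eta> (u, v))"

end

theory Submission
  imports Defs "HOL-Complex_Analysis.Great_Picard"
begin

text \<open>
  Write \<open>K\<close> for the pairing, \<open>N\<^sub>n(v)\<close> for the number of \<open>j < n\<close> such that \<open>\<rho>\<^sub>j\<close> passes through \<open>v\<close>, and
  \<open>W\<close> for the energy of \<open>\<eta>\<close>. Minimality of the energy of \<open>\<eta>\<close> bounds the potential
  \<open>\<tau> \<mapsto> \<integral> K(\<sigma>, \<tau>) d\<mu>(\<sigma>)\<close> by \<open>W\<close> everywhere. Integrating the minimality of \<open>\<rho>\<^sub>n\<close> over the competitor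
  \<open>\<sigma>\<close> with respect to the harmonic measure therefore gives \<open>n! \<le> n W\<close>; weak completeness is what
  allows this when \<open>\<mu>\<close> has atoms among the \<open>\<rho>\<^sub>j\<close>. On the other hand the sum of \<open>k!\<close> over \<open>k < n\<close> is the sum
  over all edges of \<open>\<ell>\<close> times \<open>N\<^sub>n (N\<^sub>n - 1) / 2\<close>. Hence every subsequential limit of \<open>N\<^sub>n / n\<close> is a unit
  flow of energy at most \<open>W\<close>, so it is \<open>\<eta>\<close>, which is the equidistribution. By Fatou the sum of \<open>k!\<close> over
  \<open>k < n\<close> is then at least \<open>(W - o(1)) n\<^sup>2 / 2\<close>, and since \<open>n!\<close> is monotone and at most \<open>n W\<close>, this
  forces \<open>n! / n\<close> to converge to \<open>W\<close>.
\<close>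

section \<open>Locally finite rooted trees and their ends\<close>

text \<open>The obstacle is that a ray has no usable pairing with itself: \<open>pairing\<close>
  then sums over an infinite edge set, which is 0 by convention. Statements are therefore phrased
  with visit counts on finite edge sets, or as extended nonnegative sums. Suppose a competing ray
  already occurs in the sequence. If its length is infinite, the averaged bound is infinite there
  and nothing has to be shown. If its length is finite, it branches infinitely often, and a branch
  taken far enough out is a new path that meets the old ones only along the ray.

  The potential bound is variational: a small move from \<eta> away from its conditioning on a
  vertex stays nonnegative, and the derivative of the energy in that direction gives the inequality.

  In the limit of the frequencies, conservation survives because each vertex has finitely many
  children, and at a leaf because distinct paths visit it at most once in total. Identification with
  \<eta> is strict convexity of the energy.

  The passage from sums of factorials to single ones is Tauberian: by monotonicity, a small value at
  \<open>n\<close> makes a whole block before \<open>n\<close> small.\<close>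

locale lf_tree =
  fixes T :: "'v rooted_graph"
  assumes tree: "rooted_tree T"
    and loc_fin: "tree_locally_finite T"
    and root_children: "children T (troot T) \<noteq> {}"
begin

section \<open>Parents, depth and the ancestor order\<close>

lemma edge_verts: "(u, v) \<in> tedges T \<Longrightarrow> u \<in> tverts T \<and> v \<in> tverts T"
  using tree unfolding rooted_tree_def by auto

lemma root_vert [simp]: "troot T \<in> tverts T"
  using tree unfolding rooted_tree_def by auto

lemma no_edge_root [simp]: "(u, troot T) \<notin> tedges T"
  using tree unfolding rooted_tree_def by auto

lemma parent_unique: "(u, v) \<in> tedges T \<Longrightarrow> (u', v) \<in> tedges T \<Longrightarrow> u = u'"
  using tree edge_verts no_edge_root unfolding rooted_tree_def
  by (metis DiffI empty_iff insert_iff)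

lemma parent_exists: "v \<in> tverts T \<Longrightarrow> v \<noteq> troot T \<Longrightarrow> \<exists>u. (u, v) \<in> tedges T"
  using tree unfolding rooted_tree_def by (metis DiffI empty_iff insert_iff)

lemma root_reaches: "v \<in> tverts T \<Longrightarrow> (troot T, v) \<in> (tedges T)\<^sup>*"
  using tree unfolding rooted_tree_def by auto

text \<open>Followed backwards from \<open>v\<close>, both walks agree because parents are unique,
  and they stop together because the root has no parent. This makes the \<open>THE\<close> in
  \<open>depth\<close> meaningful.\<close>

lemma relpow_root_unique:
  "(troot T, v) \<in> tedges T ^^ n \<Longrightarrow> (troot T, v) \<in> tedges T ^^ m \<Longrightarrow> n = m"
proof (induction n arbitrary: v m)
  case 0
  then show ?case by (cases m) auto
next
  case (Suc n)
  then obtain u where u: "(troot T, u) \<in> tedges T ^^ n" "(u, v) \<in> tedges T" by auto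
  then obtain m' where m: "m = Suc m'" using Suc.prems by (cases m) auto
  then obtain u' where "(troot T, u') \<in> tedges T ^^ m'" "(u', v) \<in> tedges T"
    using Suc.prems by auto
  then show ?case using Suc.IH u m parent_unique by blast
qed

definition depth :: "'v \<Rightarrow> nat" where
  "depth v = (THE n. (troot T, v) \<in> tedges T ^^ n)"

lemma depth_eqI: "(troot T, v) \<in> tedges T ^^ n \<Longrightarrow> depth v = n"
  unfolding depth_def using relpow_root_unique by blast

lemma depth_relpow: "v \<in> tverts T \<Longrightarrow> (troot T, v) \<in> tedges T ^^ depth v"
  using root_reaches depth_eqI by (metis rtrancl_imp_relpow)

lemma depth_root [simp]: "depth (troot T) = 0"
  by (rule depth_eqI) simp

lemma depth_edge: "(u, v) \<in> tedges T \<Longrightarrow> depth v = Suc (depth u)"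
  using depth_relpow[of u] edge_verts by (intro depth_eqI) auto

lemma depth_trancl: "(u, v) \<in> (tedges T)\<^sup>+ \<Longrightarrow> depth u < depth v"
  by (induction rule: trancl_induct) (auto dest: depth_edge)

lemma depth_rtrancl: "(u, v) \<in> (tedges T)\<^sup>* \<Longrightarrow> depth u \<le> depth v"
  by (metis depth_trancl less_imp_le order_refl rtranclD)

lemma depth_rtrancl_eq: "(u, v) \<in> (tedges T)\<^sup>* \<Longrightarrow> depth v \<le> depth u \<Longrightarrow> u = v"
  by (metis depth_trancl not_le rtranclD)

lemma rtrancl_edge_cases:
  assumes "(a, v) \<in> (tedges T)\<^sup>*" "(u, v) \<in> tedges T"
  shows "a = v \<or> (a, u) \<in> (tedges T)\<^sup>*"
  using assms by (metis parent_unique rtranclE)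

lemma ancestors_comparable:
  "(a, v) \<in> (tedges T)\<^sup>* \<Longrightarrow> (b, v) \<in> (tedges T)\<^sup>* \<Longrightarrow>
    (a, b) \<in> (tedges T)\<^sup>* \<or> (b, a) \<in> (tedges T)\<^sup>*"
proof (induction rule: rtrancl_induct)
  case (step y z)
  then show ?case
    by (metis rtrancl.rtrancl_into_rtrancl rtrancl_edge_cases)
qed auto

lemma depth_0: "v \<in> tverts T \<Longrightarrow> depth v = 0 \<Longrightarrow> v = troot T"
  using depth_relpow by fastforce

lemma finite_children: "v \<in> tverts T \<Longrightarrow> finite (children T v)"
  using loc_fin unfolding tree_locally_finite_def
  by (rule_tac finite_subset[of _ "neighbours T v"]) (auto simp: children_def neighbours_def)

lemma mem_children [simp]: "w \<in> children T v \<longleftrightarrow> (v, w) \<in> tedges T"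
  by (simp add: children_def)

lemma finite_level: "finite {v \<in> tverts T. depth v = n}"
proof (induction n)
  case 0
  have "{v \<in> tverts T. depth v = 0} \<subseteq> {troot T}" using depth_0 by auto
  then show ?case using finite_subset by blast
next
  case (Suc n)
  have "{v \<in> tverts T. depth v = Suc n} \<subseteq> (\<Union>u\<in>{v \<in> tverts T. depth v = n}. children T u)"
  proof
    fix v assume v: "v \<in> {v \<in> tverts T. depth v = Suc n}"
    then have "v \<noteq> troot T" by auto
    then obtain u where "(u, v) \<in> tedges T" using v parent_exists by auto
    then show "v \<in> (\<Union>u\<in>{v \<in> tverts T. depth v = n}. children T u)"
      using v edge_verts depth_edge by fastforce
  qed
  moreover have "finite \<dots>" using Suc finite_children by auto
  ultimately show ?case by (rule finite_subset)
qed

lemma countable_verts: "countable (tverts T)"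
proof -
  have "tverts T = (\<Union>n. {v \<in> tverts T. depth v = n})" by auto
  moreover have "countable (\<Union>n. {v \<in> tverts T. depth v = n})"
    by (simp add: countable_finite finite_level)
  ultimately show ?thesis by simp
qed

lemma countable_edges: "countable (tedges T)"
  by (rule countable_subset[of _ "tverts T \<times> tverts T"])
    (use edge_verts countable_verts in auto)

section \<open>Elements of the extended boundary as vertex sequences\<close>

lemma leaf_iff: "leaf T v \<longleftrightarrow> v \<in> tverts T \<and> v \<noteq> troot T \<and> children T v = {}"
proof (cases "v \<in> tverts T \<and> v \<noteq> troot T")
  case True
  then obtain u where u: "(u, v) \<in> tedges T" using parent_exists by auto
  have eq: "neighbours T v = insert u (children T v)"
    using u parent_unique by (auto simp: neighbours_def)
  \<comment> \<open>The parent lies one level up and the children one level down, so the valence is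
    one more than the number of children.\<close>
  have "u \<notin> children T v" using depth_edge[OF u] depth_edge[of v u] by auto
  then have "card (neighbours T v) = Suc (card (children T v))"
    using eq True finite_children by simp
  then show ?thesis using True finite_children by (simp add: leaf_def)
qed (auto simp: leaf_def)

text \<open>A common description of finite and infinite paths: \<open>I\<close> is an initial
  segment of the naturals, and \<open>f\<close> is irrelevant outside it. The last conjunct recovers
  the path from \<open>f\<close> and \<open>I\<close>, which is what equality of paths is proved
  from.\<close>

definition path_enum :: "'v tpath \<Rightarrow> (nat \<Rightarrow> 'v) \<Rightarrow> nat set \<Rightarrow> bool" where
  "path_enum \<sigma> f I \<longleftrightarrow>
    path_verts \<sigma> = f ` I \<and> path_edges \<sigma> = {(f i, f (Suc i)) |i. Suc i \<in> I} \<and>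
    0 \<in> I \<and> (\<forall>i. Suc i \<in> I \<longrightarrow> i \<in> I) \<and> (\<forall>i. Suc i \<in> I \<longrightarrow> (f i, f (Suc i)) \<in> tedges T) \<and>
    (\<forall>i\<in>I. Suc i \<notin> I \<longrightarrow> leaf T (f i)) \<and> f 0 = troot T \<and>
    \<sigma> = (if I = UNIV then InfPath f else FinPath (map f [0..<card I]))"

lemma path_enumD:
  assumes "path_enum \<sigma> f I"
  shows "path_verts \<sigma> = f ` I" "path_edges \<sigma> = {(f i, f (Suc i)) |i. Suc i \<in> I}"
    "0 \<in> I" "f 0 = troot T" "\<And>i. Suc i \<in> I \<Longrightarrow> i \<in> I" "\<And>i. Suc i \<in> I \<Longrightarrow> (f i, f (Suc i)) \<in> tedges T"
    "\<And>i. i \<in> I \<Longrightarrow> Suc i \<notin> I \<Longrightarrow> leaf T (f i)"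
    "\<sigma> = (if I = UNIV then InfPath f else FinPath (map f [0..<card I]))"
  using assms unfolding path_enum_def by blast+

lemma path_enum_depth:
  assumes "path_enum \<sigma> f I" "i \<in> I"
  shows "depth (f i) = i"
  using assms(2)
proof (induction i)
  case 0
  then show ?case using path_enumD(4)[OF assms(1)] by simp
next
  case (Suc i)
  then show ?case using depth_edge path_enumD(5,6)[OF assms(1)] by metis
qed

lemma path_enum_exists:
  assumes "\<sigma> \<in> ext_boundary T"
  shows "\<exists>f I. path_enum \<sigma> f I"
proof (cases \<sigma>)
  case (InfPath f)
  then show ?thesis using assms
    by (intro exI[of _ f] exI[of _ UNIV]) (auto simp: path_enum_def ext_boundary_def boundary_def leaf_paths_def)
next
  case (FinPath xs)
  then have xs: "xs \<noteq> []" "hd xs = troot T" "successively (\<lambda>u v. (u, v) \<in> tedges T) xs"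
    "leaf T (last xs)"
    using assms by (auto simp: ext_boundary_def boundary_def leaf_paths_def)
  have e: "set (zip xs (tl xs)) = {(xs ! i, xs ! Suc i) |i. Suc i < length xs}"
    by (auto simp: set_zip nth_tl)
  have ne: "{..<length xs} \<noteq> UNIV" by (metis finite_lessThan infinite_UNIV_nat)
  have lf: "\<And>i. i < length xs \<Longrightarrow> \<not> Suc i < length xs \<Longrightarrow> leaf T (xs ! i)"
    using xs by (metis One_nat_def Suc_lessI diff_Suc_1 last_conv_nth)
  have xs0: "xs ! 0 = troot T" using xs by (simp add: hd_conv_nth)
  show ?thesis
    unfolding path_enum_def
  proof (rule exI[of _ "(!) xs"], rule exI[of _ "{..<length xs}"], intro conjI)
    show "path_verts \<sigma> = (!) xs ` {..<length xs}"
      using FinPath by (auto simp: in_set_conv_nth)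
    show "path_edges \<sigma> = {(xs ! i, xs ! Suc i) |i. Suc i \<in> {..<length xs}}"
      using FinPath e by simp
    show "0 \<in> {..<length xs}" using xs(1) by simp
    show "\<forall>i. Suc i \<in> {..<length xs} \<longrightarrow> i \<in> {..<length xs}" by simp
    show "\<forall>i. Suc i \<in> {..<length xs} \<longrightarrow> (xs ! i, xs ! Suc i) \<in> tedges T"
      using xs(3) by (simp add: successively_conv_nth)
    show "\<forall>i\<in>{..<length xs}. Suc i \<notin> {..<length xs} \<longrightarrow> leaf T (xs ! i)"
      using lf by blast
    show "xs ! 0 = troot T" by (fact xs0)
    show "\<sigma> = (if {..<length xs} = UNIV then InfPath ((!) xs)
      else FinPath (map ((!) xs) [0..<card {..<length xs}]))"
      using FinPath ne by (simp add: map_nth)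
  qed
qed

lemma path_verts_subset:
  assumes "\<sigma> \<in> ext_boundary T"
  shows "path_verts \<sigma> \<subseteq> tverts T"
proof -
  obtain f I where p: "path_enum \<sigma> f I" using path_enum_exists[OF assms] by blast
  have "f i \<in> tverts T" if "i \<in> I" for i
    using that path_enumD(6,7)[OF p, of i] edge_verts[of "f i"]
    by (cases "Suc i \<in> I") (auto simp: leaf_def)
  then show ?thesis using path_enumD(1)[OF p] by auto
qed

lemma root_in_path: "\<sigma> \<in> ext_boundary T \<Longrightarrow> troot T \<in> path_verts \<sigma>"
  using path_enum_exists[of \<sigma>] path_enumD(1,3,4)[of \<sigma>] by (metis imageI)

lemma path_parent:
  assumes "\<sigma> \<in> ext_boundary T" "v \<in> path_verts \<sigma>" "(u, v) \<in> tedges T"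
  shows "u \<in> path_verts \<sigma>" "(u, v) \<in> path_edges \<sigma>"
proof -
  obtain f I where p: "path_enum \<sigma> f I" using path_enum_exists[OF assms(1)] by blast
  obtain i where i: "i \<in> I" "v = f i" using path_enumD(1)[OF p] assms by auto
  have "i \<noteq> 0" using path_enumD(4)[OF p] i assms(3) no_edge_root by metis
  then obtain k where k: "i = Suc k" by (cases i) auto
  then have "u = f k" using path_enumD(6)[OF p, of k] i assms(3) parent_unique by simp
  moreover have "k \<in> I" using path_enumD(5)[OF p] i k by simp
  ultimately show "u \<in> path_verts \<sigma>" "(u, v) \<in> path_edges \<sigma>"
    using path_enumD(1,2)[OF p] i k by auto
qed

text \<open>An edge is determined by its head because parents are unique. Questions about edges of
  paths thereby become questions about the vertices \<open>snd e\<close>.\<close>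

lemma path_edges_eq:
  assumes "\<sigma> \<in> ext_boundary T"
  shows "path_edges \<sigma> = {e \<in> tedges T. snd e \<in> path_verts \<sigma>}"
proof -
  obtain f I where p: "path_enum \<sigma> f I" using path_enum_exists[OF assms(1)] by blast
  show ?thesis
  proof (intro subset_antisym subsetI)
    fix e assume "e \<in> path_edges \<sigma>"
    then show "e \<in> {e \<in> tedges T. snd e \<in> path_verts \<sigma>}"
      unfolding path_enumD(1,2)[OF p] using path_enumD(6)[OF p] by auto
  next
    fix e assume "e \<in> {e \<in> tedges T. snd e \<in> path_verts \<sigma>}"
    then show "e \<in> path_edges \<sigma>" using path_parent(2)[OF assms, of "snd e" "fst e"] by simp
  qed
qed

lemma path_ancestor:
  assumes "\<sigma> \<in> ext_boundary T" "(u, v) \<in> (tedges T)\<^sup>*" "v \<in> path_verts \<sigma>"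
  shows "u \<in> path_verts \<sigma>"
  using assms(2,3)
proof (induction rule: converse_rtrancl_induct)
  case (step y z)
  then show ?case using path_parent(1)[OF assms(1)] by blast
qed

lemma path_comparable:
  assumes "\<sigma> \<in> ext_boundary T" "u \<in> path_verts \<sigma>" "v \<in> path_verts \<sigma>" "depth u \<le> depth v"
  shows "(u, v) \<in> (tedges T)\<^sup>*"
proof -
  obtain f I where p: "path_enum \<sigma> f I" using path_enum_exists[OF assms(1)] by blast
  have "j \<in> I \<Longrightarrow> i \<le> j \<Longrightarrow> (f i, f j) \<in> (tedges T)\<^sup>*" for i j
  proof (induction j)
    case (Suc j)
    then show ?case using path_enumD(5,6)[OF p, of j]
      by (cases "i = Suc j") (auto intro: rtrancl_into_rtrancl)
  qed auto
  then show ?thesis using assms path_enumD(1)[OF p] path_enum_depth[OF p] by auto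
qed

lemma path_depth_inj: "\<sigma> \<in> ext_boundary T \<Longrightarrow> inj_on depth (path_verts \<sigma>)"
  by (rule inj_onI) (metis depth_rtrancl_eq order_refl path_comparable)

lemma path_child_unique:
  assumes "\<sigma> \<in> ext_boundary T" "v \<in> path_verts \<sigma>" "w \<in> path_verts \<sigma>" "(u, v) \<in> tedges T" "(u, w) \<in> tedges T"
  shows "v = w"
  using path_depth_inj[OF assms(1)] assms depth_edge by (metis inj_onD)

lemma path_child_exists:
  assumes "\<sigma> \<in> ext_boundary T" "v \<in> path_verts \<sigma>" "children T v \<noteq> {}"
  shows "\<exists>w\<in>children T v. w \<in> path_verts \<sigma>"
proof -
  obtain f I where p: "path_enum \<sigma> f I" using path_enum_exists[OF assms(1)] by blast
  obtain i where i: "i \<in> I" "v = f i" using path_enumD(1)[OF p] assms by auto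
  then have "Suc i \<in> I" using path_enumD(7)[OF p] assms leaf_iff by blast
  then show ?thesis using path_enumD(1,6)[OF p] i by auto
qed

text \<open>No path is a proper initial part of another one: a path that stops does so at a leaf,
  which has no child through which the other could continue. Comparing depths shows that the
  enumerations agree where both are defined.\<close>

lemma path_verts_subset_eq:
  assumes "\<sigma> \<in> ext_boundary T" "\<tau> \<in> ext_boundary T" "path_verts \<sigma> \<subseteq> path_verts \<tau>"
  shows "\<sigma> = \<tau>"
proof -
  obtain f I where f: "path_enum \<sigma> f I" using path_enum_exists[OF assms(1)] by blast
  obtain g J where g: "path_enum \<tau> g J" using path_enum_exists[OF assms(2)] by blast
  note fD = path_enumD[OF f] and gD = path_enumD[OF g]
  have fg: "i \<in> J \<and> f i = g i" if "i \<in> I" for i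
  proof -
    have "f i \<in> g ` J" using assms(3) fD(1) gD(1) that by auto
    then obtain j where "j \<in> J" "f i = g j" by auto
    then show ?thesis using path_enum_depth[OF f that] path_enum_depth[OF g, of j] by auto
  qed
  have "i \<in> I" if "i \<in> J" for i
    using that
  proof (induction i)
    case (Suc i)
    then have i: "i \<in> I" "(g i, g (Suc i)) \<in> tedges T" using gD(5,6) by auto
    then show ?case using fD(7)[OF i(1)] fg[OF i(1)] leaf_iff by (metis empty_iff mem_children)
  qed (use fD(3) in auto)
  then have IJ: "I = J" using fg by auto
  show ?thesis
  proof (cases "I = UNIV")
    case True
    then have "f = g" using fg by auto
    then show ?thesis using fD(8) gD(8) IJ by simp
  next
    case False
    have down: "j \<in> I" if "i \<in> I" "j \<le> i" for i j
      using that
    proof (induction i)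
      case (Suc i)
      then show ?case using gD(5)[of i] IJ by (cases "j = Suc i") auto
    qed auto
    obtain k where k: "k \<notin> I" using False by auto
    then have I: "I = {..<(LEAST k. k \<notin> I)}"
      by (metis (mono_tags, lifting) LeastI down lessThan_iff not_le not_less_Least subsetI subset_antisym)
    then have "I = {..<card I}" by (metis card_lessThan)
    then have "f i = g i" if "i < card I" for i using fg that by blast
    then have "map f [0..<card I] = map g [0..<card I]" by simp
    then show ?thesis using fD(8) gD(8) IJ False by simp
  qed
qed

section \<open>The basic sets of paths through a vertex\<close>

lemma through_iff: "\<sigma> \<in> through T v \<longleftrightarrow> \<sigma> \<in> ext_boundary T \<and> v \<in> path_verts \<sigma>"
  by (simp add: through_def)

lemma finite_path_depth_le:
  "\<sigma> \<in> ext_boundary T \<Longrightarrow> finite {v \<in> path_verts \<sigma>. depth v \<le> n}"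
proof -
  assume "\<sigma> \<in> ext_boundary T"
  then have "inj_on depth {v \<in> path_verts \<sigma>. depth v \<le> n}"
    by (rule inj_on_subset[OF path_depth_inj]) auto
  moreover have "depth ` {v \<in> path_verts \<sigma>. depth v \<le> n} \<subseteq> {..n}" by auto
  ultimately show ?thesis by (meson finite_atMost inj_on_finite)
qed

text \<open>A vertex of \<open>\<sigma>\<close> missing from \<open>\<tau>\<close> bounds the depth
  of all common vertices, since \<open>\<tau>\<close> contains the ancestors of its
  vertices.\<close>

lemma finite_common_verts:
  assumes "\<sigma> \<in> ext_boundary T" "\<tau> \<in> ext_boundary T" "\<sigma> \<noteq> \<tau>"
  shows "finite (path_verts \<sigma> \<inter> path_verts \<tau>)"
proof -
  obtain v where v: "v \<in> path_verts \<sigma>" "v \<notin> path_verts \<tau>"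
    using path_verts_subset_eq assms by blast
  have "path_verts \<sigma> \<inter> path_verts \<tau> \<subseteq> {u \<in> path_verts \<sigma>. depth u \<le> depth v}"
    using v assms path_comparable path_ancestor by (smt (verit) Int_iff mem_Collect_eq nat_le_linear subsetI)
  then show ?thesis using finite_path_depth_le[OF assms(1)] finite_subset by blast
qed

lemma finite_common_edges:
  assumes "\<sigma> \<in> ext_boundary T" "\<tau> \<in> ext_boundary T" "\<sigma> \<noteq> \<tau>"
  shows "finite (path_edges \<sigma> \<inter> path_edges \<tau>)"
proof -
  have "inj_on snd (path_edges \<sigma> \<inter> path_edges \<tau>)"
    using parent_unique by (auto simp: path_edges_eq assms inj_on_def)
  moreover have "snd ` (path_edges \<sigma> \<inter> path_edges \<tau>) \<subseteq> path_verts \<sigma> \<inter> path_verts \<tau>"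
    by (auto simp: path_edges_eq assms)
  ultimately show ?thesis using finite_common_verts[OF assms] by (meson inj_on_finite)
qed

lemma through_leaf_unique:
  assumes "children T v = {}" "\<sigma> \<in> through T v" "\<tau> \<in> through T v"
  shows "\<sigma> = \<tau>"
proof (rule path_verts_subset_eq)
  show s: "\<sigma> \<in> ext_boundary T" "\<tau> \<in> ext_boundary T" using assms by (auto simp: through_iff)
  show "path_verts \<sigma> \<subseteq> path_verts \<tau>"
  proof
    fix u assume u: "u \<in> path_verts \<sigma>"
    have "(u, v) \<in> (tedges T)\<^sup>* \<or> (v, u) \<in> (tedges T)\<^sup>*"
      using path_comparable[OF s(1)] u assms nat_le_linear by (metis through_iff)
    moreover have "(v, u) \<in> (tedges T)\<^sup>* \<Longrightarrow> u = v"
      using assms(1) by (metis converse_rtranclE empty_iff mem_children)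
    ultimately show "u \<in> path_verts \<tau>" using assms s path_ancestor by (auto simp: through_iff)
  qed
qed

lemma through_root: "through T (troot T) = ext_boundary T"
  using root_in_path by (auto simp: through_iff)

lemma through_subset: "(u, v) \<in> (tedges T)\<^sup>* \<Longrightarrow> through T v \<subseteq> through T u"
  using path_ancestor by (auto simp: through_iff)

lemma through_children:
  assumes "children T v \<noteq> {}"
  shows "through T v = (\<Union>w\<in>children T v. through T w)"
proof (rule subset_antisym)
  show "through T v \<subseteq> (\<Union>w\<in>children T v. through T w)"
    using path_child_exists assms by (force simp: through_iff)
  show "(\<Union>w\<in>children T v. through T w) \<subseteq> through T v"
    by (intro UN_least through_subset) auto
qed

lemma through_disjoint:
  assumes "(v, w) \<in> tedges T" "(v, w') \<in> tedges T" "w \<noteq> w'"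
  shows "through T w \<inter> through T w' = {}"
  using path_child_unique assms by (auto simp: through_iff)

text \<open>The path from the root to \<open>v\<close> is prolonged by arbitrarily chosen children,
  either forever or up to the first childless vertex.\<close>

lemma through_nonempty:
  assumes "v \<in> tverts T"
  shows "through T v \<noteq> {}"
proof -
  obtain h where h: "h 0 = troot T" "h (depth v) = v" "\<And>i. i < depth v \<Longrightarrow> (h i, h (Suc i)) \<in> tedges T"
    using depth_relpow[OF assms] unfolding relpow_fun_conv by blast
  define nx where "nx u = (SOME w. (u, w) \<in> tedges T)" for u
  have nx: "(u, nx u) \<in> tedges T" if "children T u \<noteq> {}" for u
    unfolding nx_def by (rule someI_ex) (use that in auto)
  define f where "f i = (if i \<le> depth v then h i else (nx ^^ (i - depth v)) v)" for i
  have fs: "(f i, f (Suc i)) \<in> tedges T" if "children T (f i) \<noteq> {}" for i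
  proof (cases "i < depth v")
    case True
    then show ?thesis using h(3)[of i] by (simp add: f_def)
  next
    case False
    then have "f (Suc i) = nx (f i)"
      using h(2) by (cases "i = depth v") (simp_all add: f_def Suc_diff_le)
    then show ?thesis using nx[OF that] by simp
  qed
  have f0: "f 0 = troot T" "f (depth v) = v" using h(1,2) by (simp_all add: f_def)
  show ?thesis
  proof (cases "\<exists>k. children T (f k) = {}")
    case False
    then have "InfPath f \<in> ext_boundary T" using fs f0 by (auto simp: ext_boundary_def boundary_def)
    moreover have "v \<in> path_verts (InfPath f)" using f0 by (metis path_verts.simps(2) rangeI)
    ultimately show ?thesis using through_iff by blast
  next
    case True
    define k where "k = (LEAST k. children T (f k) = {})"
    have k: "children T (f k) = {}" unfolding k_def using True by (rule LeastI_ex)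
    have lt: "(f i, f (Suc i)) \<in> tedges T" if "i < k" for i
      using that fs not_less_Least unfolding k_def by blast
    have vk: "depth v \<le> k"
    proof (rule ccontr)
      assume "\<not> depth v \<le> k"
      then have "(f k, f (Suc k)) \<in> tedges T" using h(3)[of k] by (simp add: f_def)
      then show False using k by (metis empty_iff mem_children)
    qed
    \<comment> \<open>\<open>leaf\<close> excludes the root, so a root without children would leave
      no boundary element at all; \<open>root_children\<close> rules this out.\<close>
    have k0: "k \<noteq> 0" using k f0 root_children by auto
    then obtain k' where k': "k = Suc k'" by (cases k) auto
    then have "(f k', f k) \<in> tedges T" using lt by auto
    then have "leaf T (f k)" using k leaf_iff edge_verts no_edge_root by metis
    moreover have "successively (\<lambda>u v. (u, v) \<in> tedges T) (map f [0..<Suc k])"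
      unfolding successively_conv_nth
    proof (intro allI impI)
      fix i assume "Suc i < length (map f [0..<Suc k])"
      then show "(map f [0..<Suc k] ! i, map f [0..<Suc k] ! Suc i) \<in> tedges T"
        using lt[of i] by (simp del: upt_Suc)
    qed
    moreover have "hd (map f [0..<Suc k]) = troot T" using f0(1) by (simp add: hd_map del: upt_Suc)
    moreover have "last (map f [0..<Suc k]) = f k" by simp
    ultimately have "FinPath (map f [0..<Suc k]) \<in> ext_boundary T"
      unfolding ext_boundary_def leaf_paths_def by (simp del: upt_Suc)
    moreover have "v \<in> path_verts (FinPath (map f [0..<Suc k]))"
    proof -
      have "depth v \<in> {0..<Suc k}" using vk by simp
      then have "f (depth v) \<in> f ` {0..<Suc k}" by (rule imageI)
      then show ?thesis using f0(2) by (simp del: upt_Suc)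
    qed
    ultimately show ?thesis using through_iff by blast
  qed
qed

text \<open>The depth at which two paths separate. It is meaningful only for distinct paths, whose
  common vertices form a finite set containing the root.\<close>

definition meet_depth :: "'v tpath \<Rightarrow> 'v tpath \<Rightarrow> nat" where
  "meet_depth \<sigma> \<tau> = Max (depth ` (path_verts \<sigma> \<inter> path_verts \<tau>))"

lemma meet_depth_commute: "meet_depth \<sigma> \<tau> = meet_depth \<tau> \<sigma>"
  by (simp add: meet_depth_def Int_commute)

text \<open>The common vertices of two paths are closed under ancestors, hence form an initial
  segment of each path.\<close>

lemma mem_common_iff:
  assumes "\<sigma> \<in> ext_boundary T" "\<tau> \<in> ext_boundary T" "\<sigma> \<noteq> \<tau>" "b \<in> path_verts \<sigma>"
  shows "b \<in> path_verts \<tau> \<longleftrightarrow> depth b \<le> meet_depth \<sigma> \<tau>"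
proof
  have fin: "finite (depth ` (path_verts \<sigma> \<inter> path_verts \<tau>))"
    using finite_common_verts[OF assms(1-3)] by simp
  show "depth b \<le> meet_depth \<sigma> \<tau>" if "b \<in> path_verts \<tau>"
    unfolding meet_depth_def using fin that assms(4) by (intro Max_ge) auto
  assume le: "depth b \<le> meet_depth \<sigma> \<tau>"
  have "meet_depth \<sigma> \<tau> \<in> depth ` (path_verts \<sigma> \<inter> path_verts \<tau>)"
    unfolding meet_depth_def using fin root_in_path[OF assms(1)] root_in_path[OF assms(2)]
    by (intro Max_in) auto
  then obtain c where c: "c \<in> path_verts \<sigma>" "c \<in> path_verts \<tau>" "meet_depth \<sigma> \<tau> = depth c" by auto
  then have "(b, c) \<in> (tedges T)\<^sup>*" using path_comparable[OF assms(1) assms(4) c(1)] le by simp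
  then show "b \<in> path_verts \<tau>" using path_ancestor[OF assms(2)] c(2) by blast
qed

lemma finite_edges_depth_le: "finite {e \<in> tedges T. depth (snd e) \<le> m}"
proof -
  have "finite (\<Union>n\<le>m. {v \<in> tverts T. depth v = n})" using finite_level by auto
  moreover have "snd ` {e \<in> tedges T. depth (snd e) \<le> m} \<subseteq> (\<Union>n\<le>m. {v \<in> tverts T. depth v = n})"
    using edge_verts by auto
  moreover have "inj_on snd {e \<in> tedges T. depth (snd e) \<le> m}"
    using parent_unique by (auto simp: inj_on_def)
  ultimately show ?thesis by (meson inj_on_finite)
qed

lemma branching_other_child:
  assumes "branching T v"
  obtains w where "(v, w) \<in> tedges T" "w \<noteq> u"
proof -
  obtain a b where "(v, a) \<in> tedges T" "(v, b) \<in> tedges T" "a \<noteq> b"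
    using assms unfolding branching_def by auto
  then show thesis using that[of a] that[of b] by blast
qed

lemma ray_depth:
  assumes "f 0 = troot T" "\<And>n. (f n, f (Suc n)) \<in> tedges T"
  shows "depth (f n) = n"
  by (induction n) (use assms depth_edge[OF assms(2)] in auto)

lemma ray_reaches:
  assumes "\<And>n. (f n, f (Suc n)) \<in> tedges T" "n \<le> m"
  shows "(f n, f m) \<in> (tedges T)\<^sup>*"
  using assms(2) by (induction rule: dec_induct) (auto intro: rtrancl_into_rtrancl assms(1))

section \<open>Unit flows\<close>

lemma unit_flowD:
  assumes "unit_flow T \<theta>"
  shows "\<And>e. e \<in> tedges T \<Longrightarrow> 0 \<le> \<theta> e"
    and "\<And>u v. (u, v) \<in> tedges T \<Longrightarrow> \<theta> (u, v) = (\<Sum>w\<in>children T v. \<theta> (v, w))"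
    and "(\<Sum>v\<in>children T (troot T). \<theta> (troot T, v)) = 1"
  using assms unfolding unit_flow_def by auto

lemma flow_child_le:
  assumes "unit_flow T \<theta>" "(u, v) \<in> tedges T" "(v, w) \<in> tedges T"
  shows "\<theta> (v, w) \<le> \<theta> (u, v)"
  unfolding unit_flowD(2)[OF assms(1,2)]
  using unit_flowD(1)[OF assms(1)] assms edge_verts finite_children
  by (intro member_le_sum[of w _ "\<lambda>w. \<theta> (v, w)"]) auto

lemma flow_descendant_le:
  assumes "unit_flow T \<theta>" "(a, b) \<in> tedges T" "(b, v) \<in> (tedges T)\<^sup>*" "(u, v) \<in> tedges T"
  shows "\<theta> (u, v) \<le> \<theta> (a, b)"
  using assms(3,4)
proof (induction arbitrary: u rule: rtrancl_induct)
  case base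
  then show ?case using parent_unique assms(2) by blast
next
  case (step y z)
  then obtain x where x: "(x, y) \<in> tedges T" by (metis assms(2) rtranclE)
  have "\<theta> (u, z) \<le> \<theta> (x, y)"
    using flow_child_le[OF assms(1) x] step parent_unique by blast
  then show ?case using step.IH[OF x] by simp
qed

text \<open>The edges of the segment from the root to \<open>v\<close>, picked out by their
  heads.\<close>

definition above :: "'v \<Rightarrow> ('v \<times> 'v) set" where
  "above v = {e \<in> tedges T. (snd e, v) \<in> (tedges T)\<^sup>*}"

lemma above_root: "above (troot T) = {}"
proof -
  have False if "(a, b) \<in> tedges T" "(b, troot T) \<in> (tedges T)\<^sup>*" for a b
    using that by (metis no_edge_root rtranclE)
  then show ?thesis by (auto simp: above_def)
qed

lemma above_edge:
  assumes "(u, v) \<in> tedges T"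
  shows "above v = insert (u, v) (above u)" "(u, v) \<notin> above u"
proof -
  show "above v = insert (u, v) (above u)"
  proof (intro subset_antisym subsetI)
    fix e assume e: "e \<in> above v"
    then have "snd e = v \<or> (snd e, u) \<in> (tedges T)\<^sup>*"
      using assms rtrancl_edge_cases by (auto simp: above_def)
    then show "e \<in> insert (u, v) (above u)"
    proof
      assume "snd e = v"
      then have "e = (u, v)" using e assms parent_unique by (cases e) (auto simp: above_def)
      then show ?thesis by simp
    qed (use e in \<open>auto simp: above_def\<close>)
  next
    fix e assume "e \<in> insert (u, v) (above u)"
    then show "e \<in> above v" using assms by (auto simp: above_def intro: rtrancl_into_rtrancl)
  qed
  show "(u, v) \<notin> above u"
    using depth_rtrancl[of v u] depth_edge[OF assms] by (auto simp: above_def)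
qed

lemma finite_above: "v \<in> tverts T \<Longrightarrow> finite (above v)"
proof -
  assume "v \<in> tverts T"
  then have "(troot T, v) \<in> (tedges T)\<^sup>*" by (rule root_reaches)
  then show ?thesis by (induction rule: rtrancl_induct) (simp_all add: above_root above_edge)
qed

lemma child_towards:
  assumes "(b, v) \<in> (tedges T)\<^sup>*" "b \<noteq> v"
  obtains w where "(b, w) \<in> tedges T" "(w, v) \<in> (tedges T)\<^sup>*"
    "\<And>w'. (b, w') \<in> tedges T \<Longrightarrow> (w', v) \<in> (tedges T)\<^sup>* \<Longrightarrow> w' = w"
proof -
  obtain w where w: "(b, w) \<in> tedges T" "(w, v) \<in> (tedges T)\<^sup>*"
    using assms by (meson converse_rtranclE)
  have "w' = w" if "(b, w') \<in> tedges T" "(w', v) \<in> (tedges T)\<^sup>*" for w'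
    using ancestors_comparable[OF that(2) w(2)] depth_edge[OF that(1)] depth_edge[OF w(1)]
      depth_rtrancl_eq by (metis order_refl)
  with w show thesis by (rule that)
qed

lemma flow_sum_towards:
  assumes "(b, v) \<in> (tedges T)\<^sup>*" "b \<noteq> v" "b \<in> tverts T"
  shows "(\<Sum>w\<in>children T b. if (w, v) \<in> (tedges T)\<^sup>* then 1 else 0) = (1::real)"
proof -
  obtain w where w: "(b, w) \<in> tedges T" "(w, v) \<in> (tedges T)\<^sup>*"
    "\<And>w'. (b, w') \<in> tedges T \<Longrightarrow> (w', v) \<in> (tedges T)\<^sup>* \<Longrightarrow> w' = w"
    using child_towards assms(1,2) by blast
  have "(\<Sum>x\<in>children T b. if (x, v) \<in> (tedges T)\<^sup>* then 1 else 0)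
      = (\<Sum>x\<in>children T b. if w = x then 1 else (0::real))"
    using w by (intro sum.cong refl) (metis mem_children)
  then show ?thesis using finite_children[OF assms(3)] w(1) by simp
qed

text \<open>The flow \<open>\<eta>\<close> conditioned to pass through \<open>v\<close>; \<open>c\<close> stands for the flow of \<open>\<eta>\<close> into \<open>v\<close>.\<close>

definition cond_flow :: "('v \<times> 'v \<Rightarrow> real) \<Rightarrow> real \<Rightarrow> 'v \<Rightarrow> 'v \<times> 'v \<Rightarrow> real" where
  "cond_flow \<eta> c v e =
    (if (snd e, v) \<in> (tedges T)\<^sup>* then 1 else if (v, fst e) \<in> (tedges T)\<^sup>* then \<eta> e / c else 0)"

text \<open>One unit runs from the root to \<open>v\<close>, and below \<open>v\<close> the flow
  \<eta> is rescaled by \<open>1 / c\<close>. The two parts match at \<open>v\<close> because \<eta>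
  sends exactly \<open>c\<close> into it; off the segment and off the descendants of
  \<open>v\<close> everything vanishes.\<close>

lemma unit_flow_cond:
  assumes \<eta>: "unit_flow T \<eta>" and uv: "(u, v) \<in> tedges T" and c: "c = \<eta> (u, v)" "0 < c"
  shows "unit_flow T (cond_flow \<eta> c v)"
  unfolding unit_flow_def
proof (intro conjI ballI)
  note \<eta>D = unit_flowD[OF \<eta>]
  have not_back: "(w, v) \<notin> (tedges T)\<^sup>*" if "(v, b) \<in> (tedges T)\<^sup>*" "(b, w) \<in> tedges T" for b w
    using depth_rtrancl[OF that(1)] depth_edge[OF that(2)] depth_rtrancl[of w v] by auto
  have towards: "(\<Sum>w\<in>children T b. cond_flow \<eta> c v (b, w)) = 1"
    if "(b, v) \<in> (tedges T)\<^sup>*" "b \<noteq> v" "b \<in> tverts T" for b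
  proof -
    have "(v, b) \<notin> (tedges T)\<^sup>*" using that depth_rtrancl depth_rtrancl_eq by blast
    then have "(\<Sum>w\<in>children T b. cond_flow \<eta> c v (b, w))
      = (\<Sum>w\<in>children T b. if (w, v) \<in> (tedges T)\<^sup>* then 1 else 0)"
      by (intro sum.cong) (auto simp: cond_flow_def)
    then show ?thesis using flow_sum_towards[OF that] by simp
  qed
  show "0 \<le> cond_flow \<eta> c v e" if "e \<in> tedges T" for e
    using \<eta>D(1)[OF that] c by (simp add: cond_flow_def)
  have "troot T \<noteq> v" using uv by auto
  then show "(\<Sum>w\<in>children T (troot T). cond_flow \<eta> c v (troot T, w)) = 1"
    using towards[of "troot T"] root_reaches edge_verts[OF uv] by auto
  fix e assume e: "e \<in> tedges T"
  obtain a b where ab: "e = (a, b)" by (cases e)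
  note abE = e[unfolded ab]
  have "cond_flow \<eta> c v (a, b) = (\<Sum>w\<in>children T b. cond_flow \<eta> c v (b, w))"
  proof (cases "(b, v) \<in> (tedges T)\<^sup>*")
    case True
    then have one: "cond_flow \<eta> c v (a, b) = 1" by (simp add: cond_flow_def)
    show ?thesis
    proof (cases "b = v")
      case True
      then have "a = u" using parent_unique uv abE by blast
      have "(\<Sum>w\<in>children T b. cond_flow \<eta> c v (b, w)) = (\<Sum>w\<in>children T b. \<eta> (b, w) / c)"
        using True not_back[of b] by (intro sum.cong) (auto simp: cond_flow_def)
      also have "\<dots> = (\<Sum>w\<in>children T b. \<eta> (b, w)) / c" by (simp add: sum_divide_distrib)
      also have "\<dots> = \<eta> (a, b) / c" using \<eta>D(2)[OF abE] by simp
      finally show ?thesis using one c True \<open>a = u\<close> by simp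
    next
      case False
      then show ?thesis using one towards \<open>(b, v) \<in> (tedges T)\<^sup>*\<close> edge_verts[OF abE] by simp
    qed
  next
    case bv: False
    show ?thesis
    proof (cases "(v, b) \<in> (tedges T)\<^sup>*")
      case True
      then have va: "(v, a) \<in> (tedges T)\<^sup>*" using rtrancl_edge_cases[OF True abE] bv by auto
      have "(\<Sum>w\<in>children T b. cond_flow \<eta> c v (b, w)) = (\<Sum>w\<in>children T b. \<eta> (b, w) / c)"
        using True not_back[of b] by (intro sum.cong) (auto simp: cond_flow_def)
      also have "\<dots> = (\<Sum>w\<in>children T b. \<eta> (b, w)) / c" by (simp add: sum_divide_distrib)
      also have "\<dots> = \<eta> (a, b) / c" using \<eta>D(2)[OF abE] by simp
      finally show ?thesis using bv va by (simp add: cond_flow_def)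
    next
      case False
      then have "(v, a) \<notin> (tedges T)\<^sup>*" using abE by (meson rtrancl.rtrancl_into_rtrancl)
      moreover have "(w, v) \<notin> (tedges T)\<^sup>*" if "(b, w) \<in> tedges T" for w
        using that bv by (meson converse_rtrancl_into_rtrancl)
      ultimately show ?thesis using bv False by (simp add: cond_flow_def)
    qed
  qed
  then show "case e of (a, b) \<Rightarrow> cond_flow \<eta> c v (a, b) = (\<Sum>w\<in>children T b. cond_flow \<eta> c v (b, w))"
    by (simp add: ab)
qed

text \<open>The coefficients may be negative, as the first variation requires; nonnegativity of the
  combination is therefore a separate premise.\<close>

lemma unit_flow_combination:
  assumes "unit_flow T \<eta>" "unit_flow T \<theta>" "a + b = 1"
    and "\<And>e. e \<in> tedges T \<Longrightarrow> 0 \<le> a * \<eta> e + b * \<theta> e"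
  shows "unit_flow T (\<lambda>e. a * \<eta> e + b * \<theta> e)"
  unfolding unit_flow_def
proof (intro conjI ballI)
  note D = unit_flowD[OF assms(1)] and D' = unit_flowD[OF assms(2)]
  show "0 \<le> a * \<eta> e + b * \<theta> e" if "e \<in> tedges T" for e using assms(4)[OF that] .
  show "(\<Sum>v\<in>children T (troot T). a * \<eta> (troot T, v) + b * \<theta> (troot T, v)) = 1"
    using D(3) D'(3) assms(3) by (simp add: sum.distrib flip: sum_distrib_left)
  show "case e of (u, v) \<Rightarrow> a * \<eta> (u, v) + b * \<theta> (u, v)
      = (\<Sum>w\<in>children T v. a * \<eta> (v, w) + b * \<theta> (v, w))" if "e \<in> tedges T" for e
  proof -
    obtain u v where e: "e = (u, v)" by (cases e)
    show ?thesis
      unfolding e case_prod_conv using D(2)[of u v] D'(2)[of u v] that e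
      by (simp add: sum.distrib flip: sum_distrib_left)
  qed
qed

text \<open>A vertex with positive outflow passes a positive amount to some child, whose outflow
  equals that amount; the choice can be repeated forever.\<close>

lemma positive_flow_ray:
  assumes "unit_flow T \<theta>"
  obtains f where "f 0 = troot T" "\<And>n. (f n, f (Suc n)) \<in> tedges T" "\<And>n. 0 < \<theta> (f n, f (Suc n))"
proof -
  note D = unit_flowD[OF assms]
  have pos_child: "\<exists>w. (v, w) \<in> tedges T \<and> 0 < \<theta> (v, w)" if "0 < (\<Sum>w\<in>children T v. \<theta> (v, w))" for v
  proof (rule ccontr)
    assume "\<nexists>w. (v, w) \<in> tedges T \<and> 0 < \<theta> (v, w)"
    then have "(\<Sum>w\<in>children T v. \<theta> (v, w)) \<le> 0" by (intro sum_nonpos) (auto simp: not_less)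
    then show False using that by simp
  qed
  have "\<exists>f. \<forall>n. (0 < (\<Sum>w\<in>children T (f n). \<theta> (f n, w)) \<and> (n = 0 \<longrightarrow> f n = troot T)) \<and>
      ((f n, f (Suc n)) \<in> tedges T \<and> 0 < \<theta> (f n, f (Suc n)))"
  proof (rule dependent_nat_choice)
    show "\<exists>v. 0 < (\<Sum>w\<in>children T v. \<theta> (v, w)) \<and> (0 = (0::nat) \<longrightarrow> v = troot T)"
      using D(3) by (intro exI[of _ "troot T"]) simp
    fix v and n :: nat
    assume "0 < (\<Sum>w\<in>children T v. \<theta> (v, w)) \<and> (n = 0 \<longrightarrow> v = troot T)"
    then obtain w where w: "(v, w) \<in> tedges T" "0 < \<theta> (v, w)" using pos_child by blast
    then show "\<exists>w. (0 < (\<Sum>x\<in>children T w. \<theta> (w, x)) \<and> (Suc n = 0 \<longrightarrow> w = troot T)) \<and>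
        (v, w) \<in> tedges T \<and> 0 < \<theta> (v, w)"
      using D(2)[OF w(1)] by (intro exI[of _ w]) simp
  qed
  then show thesis using that by blast
qed

end

section \<open>The potential of the current flow\<close>

locale tree_network = lf_tree T for T :: "'v rooted_graph" +
  fixes l :: "'v \<times> 'v \<Rightarrow> real"
  assumes len: "length_function T l"
begin

lemma len_pos: "e \<in> tedges T \<Longrightarrow> 0 < l e"
  using len by (simp add: length_function_def)

text \<open>The voltage drop from the root to \<open>v\<close> under \<open>\<theta>\<close>, with
  lengths as resistances.\<close>

definition potential :: "('v \<times> 'v \<Rightarrow> real) \<Rightarrow> 'v \<Rightarrow> real" where
  "potential \<theta> v = (\<Sum>e\<in>above v. l e * \<theta> e)"

lemma potential_root: "potential \<theta> (troot T) = 0"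
  by (simp add: potential_def above_root)

lemma potential_edge:
  assumes "(u, v) \<in> tedges T"
  shows "potential \<theta> v = potential \<theta> u + l (u, v) * \<theta> (u, v)"
  using above_edge[OF assms] finite_above[of u] edge_verts[OF assms]
  by (simp add: potential_def)

text \<open>Apart from the finitely many edges above \<open>v\<close>, the conditioned flow is at
  most \<eta> divided by \<open>c\<close>.\<close>

lemma finite_energy_cond:
  assumes fe: "finite_energy T l \<eta>" and v: "v \<in> tverts T"
  shows "finite_energy T l (cond_flow \<eta> c v)"
proof -
  have 1: "(\<lambda>e. if e \<in> above v then l e else 0) summable_on tedges T"
  proof (rule summable_on_cong_neutral[THEN iffD1])
    show "l summable_on above v" using finite_above[OF v] by simp
  qed (auto simp: above_def)
  have 2: "(\<lambda>e. (1 / c\<^sup>2) * (l e * (\<eta> e)\<^sup>2)) summable_on tedges T"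
    using fe unfolding finite_energy_def by (rule summable_on_cmult_right)
  show ?thesis unfolding finite_energy_def
  proof (rule summable_on_comparison_test[OF summable_on_add[OF 1 2]])
    fix e assume e: "e \<in> tedges T"
    note p = len_pos[OF e]
    show "l e * (cond_flow \<eta> c v e)\<^sup>2 \<le> (if e \<in> above v then l e else 0) + 1 / c\<^sup>2 * (l e * (\<eta> e)\<^sup>2)"
      using p e by (auto simp: cond_flow_def above_def power_divide)
    show "0 \<le> l e * (cond_flow \<eta> c v e)\<^sup>2" using p by simp
  qed
qed

definition cross_energy :: "('v \<times> 'v \<Rightarrow> real) \<Rightarrow> ('v \<times> 'v \<Rightarrow> real) \<Rightarrow> real" where
  "cross_energy \<eta> \<theta> = (\<Sum>\<^sub>\<infinity>e\<in>tedges T. l e * (\<eta> e * \<theta> e))"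

lemma summable_cross:
  assumes "finite_energy T l \<eta>" "finite_energy T l \<theta>"
  shows "(\<lambda>e. l e * (\<eta> e * \<theta> e)) summable_on tedges T"
proof (rule abs_summable_summable, rule summable_on_comparison_test)
  show "(\<lambda>e. l e * (\<eta> e)\<^sup>2 + l e * (\<theta> e)\<^sup>2) summable_on tedges T"
    using assms unfolding finite_energy_def by (rule summable_on_add)
  fix e assume e: "e \<in> tedges T"
  have "2 * \<bar>\<eta> e * \<theta> e\<bar> \<le> (\<eta> e)\<^sup>2 + (\<theta> e)\<^sup>2"
    using sum_squares_bound[of "\<bar>\<eta> e\<bar>" "\<bar>\<theta> e\<bar>"] by (simp add: abs_mult)
  then have "\<bar>\<eta> e * \<theta> e\<bar> \<le> (\<eta> e)\<^sup>2 + (\<theta> e)\<^sup>2" by simp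
  then have "l e * \<bar>\<eta> e * \<theta> e\<bar> \<le> l e * ((\<eta> e)\<^sup>2 + (\<theta> e)\<^sup>2)"
    using len_pos[OF e] by (intro mult_left_mono) auto
  then show "norm (l e * (\<eta> e * \<theta> e)) \<le> l e * (\<eta> e)\<^sup>2 + l e * (\<theta> e)\<^sup>2"
    using len_pos[OF e] by (simp add: abs_mult algebra_simps)
qed simp

lemma energy_combination:
  assumes "finite_energy T l \<eta>" "finite_energy T l \<theta>"
  shows "finite_energy T l (\<lambda>e. a * \<eta> e + b * \<theta> e)" (is ?fin)
    and "energy T l (\<lambda>e. a * \<eta> e + b * \<theta> e)
      = a\<^sup>2 * energy T l \<eta> + 2 * a * b * cross_energy \<eta> \<theta> + b\<^sup>2 * energy T l \<theta>" (is ?en)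
proof -
  let ?f = "\<lambda>e. a\<^sup>2 * (l e * (\<eta> e)\<^sup>2)" and ?g = "\<lambda>e. 2 * a * b * (l e * (\<eta> e * \<theta> e))"
    and ?h = "\<lambda>e. b\<^sup>2 * (l e * (\<theta> e)\<^sup>2)"
  have eq: "l e * (a * \<eta> e + b * \<theta> e)\<^sup>2 = ?f e + ?g e + ?h e" for e
    by (simp add: power2_eq_square algebra_simps)
  have f: "?f summable_on tedges T" and h: "?h summable_on tedges T"
    using assms unfolding finite_energy_def by (auto intro: summable_on_cmult_right)
  have g: "?g summable_on tedges T"
    by (rule summable_on_cmult_right[OF summable_cross[OF assms]])
  have fg: "(\<lambda>e. ?f e + ?g e) summable_on tedges T" by (rule summable_on_add[OF f g])
  show ?fin unfolding finite_energy_def eq by (rule summable_on_add[OF fg h])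
  show ?en unfolding energy_def cross_energy_def eq
    using assms summable_cross[OF assms] unfolding finite_energy_def
    by (subst infsum_add[OF fg h], subst infsum_add[OF f g])
      (simp add: infsum_cmult_right)
qed

lemma energy_nonneg: "0 \<le> energy T l \<theta>"
  unfolding energy_def by (intro infsum_nonneg) (simp add: len_pos less_imp_le)

text \<open>
  If \<open>\<eta>\<close> sends some flow into \<open>v\<close>, it can be perturbed away from its conditioning on \<open>v\<close>;
  minimality makes the first variation nonnegative.
\<close>

lemma potential_le_energy:
  assumes cf: "unit_current_flow T l \<eta>" and v: "v \<in> tverts T"
  shows "potential \<eta> v \<le> energy T l \<eta>"
  using root_reaches[OF v]
proof (induction rule: rtrancl_induct)
  case base
  then show ?case by (simp add: potential_root energy_nonneg)
next
  case (step u v)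
  define c where "c = \<eta> (u, v)"
  define W where "W = energy T l \<eta>"
  have \<eta>: "unit_flow T \<eta>" "finite_energy T l \<eta>"
    and min: "\<And>\<theta>. unit_flow T \<theta> \<Longrightarrow> finite_energy T l \<theta> \<Longrightarrow> W \<le> energy T l \<theta>"
    using cf unfolding unit_current_flow_def W_def by auto
  note \<eta>D = unit_flowD[OF \<eta>(1)]
  have v: "v \<in> tverts T" using edge_verts[OF step(2)] by simp
  show ?case
  proof (cases "c = 0")
    \<comment> \<open>An edge carrying no flow adds nothing to the potential, so the bound at the
      parent suffices.\<close>
    case True
    then show ?thesis using step potential_edge[OF step(2)] by (simp add: c_def)
  next
    case False
    then have c: "c > 0" using \<eta>D(1)[OF step(2)] by (simp add: c_def)
    define \<theta> where "\<theta> = cond_flow \<eta> c v"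
    have \<theta>: "unit_flow T \<theta>" "finite_energy T l \<theta>"
      unfolding \<theta>_def
      using unit_flow_cond[OF \<eta>(1) step(2) c_def c] finite_energy_cond[OF \<eta>(2) v] by auto
    define B where "B = cross_energy \<eta> \<theta>"
    define W' where "W' = energy T l \<theta>"
    have key: "2 * (B - W) \<le> t * (W - 2 * B + W')" if t: "0 < t" "t \<le> c" for t
    proof -
      \<comment> \<open>This is \<eta> moved by \<open>t\<close> away from \<open>\<theta>\<close>.
        It stays nonnegative for \<open>t \<le> c\<close>: on the segment to \<open>v\<close> the
        flow \<eta> is at least \<open>c\<close>, and below \<open>v\<close> the subtracted part is
        at most \<eta>. Expanding the energy and dividing by \<open>t\<close> leaves the claim, in
        which \<open>t\<close> later tends to 0.\<close>
      let ?z = "\<lambda>e. (1 + t) * \<eta> e + (- t) * \<theta> e"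
      have "unit_flow T ?z"
      proof (rule unit_flow_combination[OF \<eta>(1) \<theta>(1)])
        fix e assume e: "e \<in> tedges T"
        note n = \<eta>D(1)[OF e]
        show "0 \<le> (1 + t) * \<eta> e + - t * \<theta> e"
        proof (cases "(snd e, v) \<in> (tedges T)\<^sup>*")
          case True
          then have "c \<le> \<eta> e"
            using flow_descendant_le[OF \<eta>(1), of "fst e" "snd e" v u] step(2) e by (simp add: c_def)
          moreover have "0 \<le> t * \<eta> e" using t n by simp
          ultimately have "t \<le> \<eta> e + t * \<eta> e" using t by linarith
          then show ?thesis using True by (simp add: \<theta>_def cond_flow_def algebra_simps)
        next
          case False
          have "t * \<eta> e \<le> c * \<eta> e" using t n by (intro mult_right_mono) auto
          then have "t * (\<eta> e / c) \<le> \<eta> e" using c by (simp add: field_simps)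
          moreover have "0 \<le> t * \<eta> e" using t n by simp
          ultimately have "t * (\<eta> e / c) \<le> (1 + t) * \<eta> e" by (simp add: algebra_simps)
          then show ?thesis using False n t by (simp add: \<theta>_def cond_flow_def)
        qed
      qed simp
      then have "W \<le> energy T l ?z" using min energy_combination(1)[OF \<eta>(2) \<theta>(2)] by blast
      also have "\<dots> = (1 + t)\<^sup>2 * W + 2 * (1 + t) * (- t) * B + (- t)\<^sup>2 * W'"
        unfolding W_def B_def W'_def by (rule energy_combination(2)[OF \<eta>(2) \<theta>(2)])
      finally have "t * (2 * (B - W)) \<le> t * (t * (W - 2 * B + W'))"
        by (simp add: power2_eq_square algebra_simps)
      then show ?thesis using t by simp
    qed
    have "2 * (B - W) \<le> 0"
    proof (rule tendsto_lowerbound)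
      show "((\<lambda>t. t * (W - 2 * B + W')) \<longlongrightarrow> 0) (at_right 0)"
        by (auto intro!: tendsto_eq_intros)
      show "\<forall>\<^sub>F t in at_right 0. 2 * (B - W) \<le> t * (W - 2 * B + W')"
        unfolding eventually_at_right_field using key c by (intro exI[of _ c]) auto
    qed simp
    \<comment> \<open>\<open>\<theta>\<close> equals 1 on the edges above \<open>v\<close>, and the
      remaining terms of the cross energy are nonnegative.\<close>
    moreover have "potential \<eta> v \<le> B"
    proof -
      have "potential \<eta> v = (\<Sum>e\<in>above v. l e * (\<eta> e * \<theta> e))"
        unfolding potential_def by (intro sum.cong) (auto simp: above_def \<theta>_def cond_flow_def)
      also have "\<dots> \<le> B"
        unfolding B_def cross_energy_def
        using summable_cross[OF \<eta>(2) \<theta>(2)] finite_above[OF v] \<eta>D(1) unit_flowD(1)[OF \<theta>(1)] len_pos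
        by (intro finite_sum_le_infsum) (auto simp: above_def less_imp_le)
      finally show ?thesis .
    qed
    ultimately show ?thesis by (simp add: W_def)
  qed
qed

text \<open>Strict convexity: minimality tested on the midpoint makes the cross energy at least the
  minimum, so the energy of the difference is at most 0 and each of its terms vanishes.\<close>

lemma current_flow_unique:
  assumes cf: "unit_current_flow T l \<eta>"
    and \<theta>: "unit_flow T \<theta>" "finite_energy T l \<theta>" "energy T l \<theta> \<le> energy T l \<eta>"
    and e: "e \<in> tedges T"
  shows "\<theta> e = \<eta> e"
proof -
  have \<eta>: "unit_flow T \<eta>" "finite_energy T l \<eta>"
    and min: "\<And>\<theta>. unit_flow T \<theta> \<Longrightarrow> finite_energy T l \<theta> \<Longrightarrow> energy T l \<eta> \<le> energy T l \<theta>"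
    using cf unfolding unit_current_flow_def by auto
  have "unit_flow T (\<lambda>e. (1/2) * \<eta> e + (1/2) * \<theta> e)"
    using unit_flowD(1)[OF \<eta>(1)] unit_flowD(1)[OF \<theta>(1)]
    by (intro unit_flow_combination[OF \<eta>(1) \<theta>(1)]) auto
  then have "energy T l \<eta> \<le> energy T l (\<lambda>e. (1/2) * \<eta> e + (1/2) * \<theta> e)"
    using min energy_combination(1)[OF \<eta>(2) \<theta>(2)] by blast
  then have "energy T l \<eta> \<le> cross_energy \<eta> \<theta>"
    unfolding energy_combination(2)[OF \<eta>(2) \<theta>(2)] using \<theta>(3) by (simp add: power2_eq_square)
  then have le: "energy T l (\<lambda>e. 1 * \<eta> e + (-1) * \<theta> e) \<le> 0"
    unfolding energy_combination(2)[OF \<eta>(2) \<theta>(2)] using \<theta>(3) by simp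
  have "l e * (1 * \<eta> e + (-1) * \<theta> e)\<^sup>2 = 0"
    using e le energy_combination(1)[OF \<eta>(2) \<theta>(2), of 1 "-1"] len_pos
    unfolding energy_def finite_energy_def
    by (intro nonneg_infsum_le_0D[of "\<lambda>e. l e * (1 * \<eta> e + (-1) * \<theta> e)\<^sup>2" "tedges T"]) (auto simp: less_imp_le)
  then show ?thesis using len_pos[OF e] by simp
qed

section \<open>Existence of factorial-determining sequences\<close>

text \<open>
  The competitors closest to \<open>f j\<close> are ordered by the depth at which they leave \<open>f j\<close>, and the
  objective is monotone in that depth. So each \<open>j\<close> contributes a single candidate, although there
  may be infinitely many exit points.
\<close>

lemma minimizer_exists:
  fixes f :: "nat \<Rightarrow> 'v tpath"
  assumes f: "\<And>j. j < n \<Longrightarrow> f j \<in> ext_boundary T" and inf: "infinite (ext_boundary T)"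
  shows "\<exists>x \<in> ext_boundary T - f ` {..<n}. \<forall>\<sigma>\<in>ext_boundary T - f ` {..<n}.
    (\<Sum>j<n. pairing l x (f j)) \<le> (\<Sum>j<n. pairing l \<sigma> (f j))"
proof -
  define S where "S = ext_boundary T - f ` {..<n}"
  define F where "F \<sigma> = (\<Sum>j<n. pairing l \<sigma> (f j))" for \<sigma>
  have "infinite S" unfolding S_def using inf by (simp add: Diff_infinite_finite)
  then obtain s where s: "s \<in> S" by (metis finite.emptyI ex_in_conv)
  have "\<exists>x\<in>S. \<forall>\<sigma>\<in>S. F x \<le> F \<sigma>"
  proof (cases "n = 0")
    case True
    then show ?thesis using s by (auto simp: F_def)
  next
    case False
    \<comment> \<open>\<open>R j\<close> collects the competitors that follow \<open>f j\<close> at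
      least as far as any other earlier path.\<close>
    define R where "R j = {\<tau> \<in> S. \<forall>i<n. meet_depth \<tau> (f i) \<le> meet_depth \<tau> (f j)}" for j
    have S_cover: "\<exists>j<n. \<tau> \<in> R j" if "\<tau> \<in> S" for \<tau>
    proof -
      have ne: "{..<n} \<noteq> {}" using False by auto
      obtain j where j: "j \<in> {..<n}" "Max ((\<lambda>i. meet_depth \<tau> (f i)) ` {..<n}) = meet_depth \<tau> (f j)"
        by (rule obtains_MAX[OF finite_lessThan ne])
      have "meet_depth \<tau> (f i) \<le> meet_depth \<tau> (f j)" if "i < n" for i
        unfolding j(2)[symmetric] using that by (intro Max_ge) auto
      then show ?thesis using that j(1) by (auto simp: R_def)
    qed
    \<comment> \<open>An edge shared by \<open>\<tau>\<close> and \<open>f i\<close> is no deeper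
      than the separation of \<open>\<tau>\<close> from \<open>f j\<close>, so it lies on
      \<open>f j\<close>; as \<open>\<tau>'\<close> leaves \<open>f j\<close> no earlier, it lies on
      \<open>\<tau>'\<close> too.\<close>
    have mono: "F \<tau> \<le> F \<tau>'"
      if "j < n" "\<tau> \<in> R j" "\<tau>' \<in> R j" "meet_depth \<tau> (f j) \<le> meet_depth \<tau>' (f j)" for j \<tau> \<tau>'
      unfolding F_def
    proof (rule sum_mono)
      fix i assume i: "i \<in> {..<n}"
      have P: "\<tau> \<in> ext_boundary T" "\<tau>' \<in> ext_boundary T" "f i \<in> ext_boundary T" "f j \<in> ext_boundary T"
        and ne: "\<tau> \<noteq> f i" "\<tau>' \<noteq> f i" "\<tau> \<noteq> f j" "\<tau>' \<noteq> f j"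
        using that i f by (auto simp: R_def S_def)
      have "path_edges \<tau> \<inter> path_edges (f i) \<subseteq> path_edges \<tau>' \<inter> path_edges (f i)"
      proof
        fix e assume e: "e \<in> path_edges \<tau> \<inter> path_edges (f i)"
        then have b: "snd e \<in> path_verts \<tau>" "snd e \<in> path_verts (f i)" "e \<in> tedges T"
          by (auto simp: path_edges_eq P)
        then have "depth (snd e) \<le> meet_depth \<tau> (f i)" using mem_common_iff P ne by blast
        also have "\<dots> \<le> meet_depth \<tau> (f j)" using that i by (auto simp: R_def)
        finally have d: "depth (snd e) \<le> meet_depth \<tau> (f j)" .
        then have "snd e \<in> path_verts (f j)" using mem_common_iff[OF P(1,4) ne(3) b(1)] by simp
        moreover have "depth (snd e) \<le> meet_depth (f j) \<tau>'"
          using d that(4) by (simp add: meet_depth_commute[of "f j"])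
        ultimately have "snd e \<in> path_verts \<tau>'"
          using mem_common_iff[OF P(4,2) ne(4)[symmetric]] by simp
        then show "e \<in> path_edges \<tau>' \<inter> path_edges (f i)" using b by (auto simp: path_edges_eq P)
      qed
      then show "pairing l \<tau> (f i) \<le> pairing l \<tau>' (f i)"
        unfolding pairing_def using finite_common_edges[OF P(2,3) ne(2)] len_pos
        by (intro sum_mono2) (auto simp: path_edges_eq P less_imp_le)
    qed
    define best where "best j = arg_min (\<lambda>\<tau>. meet_depth \<tau> (f j)) (\<lambda>\<tau>. \<tau> \<in> R j)" for j
    have best: "best j \<in> R j" "meet_depth (best j) (f j) \<le> meet_depth \<tau> (f j)" if "\<tau> \<in> R j" for j \<tau>
      using arg_min_nat_lemma[of "\<lambda>\<tau>. \<tau> \<in> R j" \<tau> "\<lambda>\<tau>. meet_depth \<tau> (f j)"] that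
      unfolding best_def by auto
    define G where "G = best ` {j. j < n \<and> R j \<noteq> {}}"
    have G: "finite G" "G \<noteq> {}"
      using S_cover[OF s] by (auto simp: G_def)
    obtain x where x: "x \<in> G" "\<And>y. y \<in> G \<Longrightarrow> F x \<le> F y"
      using arg_min_if_finite[OF G, of F] by (meson not_le)
    have "x \<in> S" using x(1) best(1) by (auto simp: G_def R_def)
    moreover have "F x \<le> F \<sigma>" if \<sigma>: "\<sigma> \<in> S" for \<sigma>
    proof -
      obtain j where j: "j < n" "\<sigma> \<in> R j" using S_cover[OF \<sigma>] by auto
      then have "F x \<le> F (best j)" using x(2) by (auto simp: G_def)
      also have "\<dots> \<le> F \<sigma>" using mono[OF j(1) best(1)[OF j(2)] j(2) best(2)[OF j(2)]] .
      finally show ?thesis .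
    qed
    ultimately show ?thesis by blast
  qed
  then show ?thesis by (simp add: S_def F_def)
qed

text \<open>The condition on the \<open>n\<close>-th element involves only the earlier ones, so
  well-founded dependent choice applies as soon as each finite stage has a minimizer.\<close>

lemma factorial_determining_exists:
  assumes inf: "infinite (ext_boundary T)"
  shows "\<exists>\<rho>. factorial_determining T l \<rho>"
  unfolding factorial_determining_def
proof (rule dependent_wf_choice[OF wf_less_than])
  fix f g :: "nat \<Rightarrow> 'v tpath" and n r
  assume "\<And>z. (z, n) \<in> less_than \<Longrightarrow> f z = g z"
  then have fg: "f z = g z" if "z < n" for z using that by auto
  have "f ` {..<n} = g ` {..<n}" using fg by auto
  moreover have "(\<Sum>j<n. pairing l \<sigma> (f j)) = (\<Sum>j<n. pairing l \<sigma> (g j))" for \<sigma>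
    using fg by auto
  ultimately show "(r \<in> ext_boundary T - f ` {..<n} \<and>
      (\<forall>\<sigma>\<in>ext_boundary T - f ` {..<n}. (\<Sum>j<n. pairing l r (f j)) \<le> (\<Sum>j<n. pairing l \<sigma> (f j)))) =
    (r \<in> ext_boundary T - g ` {..<n} \<and>
      (\<forall>\<sigma>\<in>ext_boundary T - g ` {..<n}. (\<Sum>j<n. pairing l r (g j)) \<le> (\<Sum>j<n. pairing l \<sigma> (g j))))"
    by simp
next
  fix n :: nat and f :: "nat \<Rightarrow> 'v tpath"
  assume "\<And>y. (y, n) \<in> less_than \<Longrightarrow> f y \<in> ext_boundary T - f ` {..<y} \<and>
      (\<forall>\<sigma>\<in>ext_boundary T - f ` {..<y}. (\<Sum>j<y. pairing l (f y) (f j)) \<le> (\<Sum>j<y. pairing l \<sigma> (f j)))"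
  then have "f j \<in> ext_boundary T" if "j < n" for j using that by auto
  from minimizer_exists[of n f, OF this inf]
  show "\<exists>r. r \<in> ext_boundary T - f ` {..<n} \<and>
      (\<forall>\<sigma>\<in>ext_boundary T - f ` {..<n}. (\<Sum>j<n. pairing l r (f j)) \<le> (\<Sum>j<n. pairing l \<sigma> (f j)))"
    by blast
qed

text \<open>Weak completeness applied to the tail from \<open>m\<close>: a ray of finite length
  branches at arbitrarily large depth.\<close>

lemma ray_branching:
  assumes wc: "weakly_complete T l" and f: "\<And>n. (f n, f (Suc n)) \<in> tedges T"
    and sum: "summable (\<lambda>n. l (f n, f (Suc n)))"
  shows "\<exists>n\<ge>m. branching T (f n)"
proof (rule ccontr)
  assume no: "\<not> ?thesis"
  define g where "g n = f (n + m)" for n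
  have "f m \<in> tverts T" using f edge_verts by blast
  moreover have "g 0 = f m" "\<forall>n. (g n, g (Suc n)) \<in> tedges T" "\<forall>n\<ge>1. \<not> branching T (g n)"
    using no f by (auto simp: g_def)
  ultimately have "\<not> summable (\<lambda>n. l (g n, g (Suc n)))"
    using wc unfolding weakly_complete_def by blast
  moreover have "summable (\<lambda>n. l (g n, g (Suc n)))"
    using summable_ignore_initial_segment[OF sum, of m] by (simp add: g_def)
  ultimately show False by simp
qed

text \<open>Along a ray carrying positive flow there are infinitely many branchings, each giving an
  element that leaves the ray at its own depth. If branching stopped, the flow would be constant
  from there on, finite energy would make the ray's length finite, and weak completeness would be
  violated.\<close>

lemma infinite_ext_boundary:
  assumes \<theta>: "unit_flow T \<theta>" "finite_energy T l \<theta>" and wc: "weakly_complete T l"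
  shows "infinite (ext_boundary T)"
proof -
  obtain f where f: "f 0 = troot T" "\<And>n. (f n, f (Suc n)) \<in> tedges T" "\<And>n. 0 < \<theta> (f n, f (Suc n))"
    using positive_flow_ray[OF \<theta>(1)] by blast
  have branch: "\<exists>n\<ge>m. branching T (f n)" for m
  proof (rule ccontr)
    assume no: "\<not> ?thesis"
    have only: "children T (f n) = {f (Suc n)}" if "n \<ge> m" for n
      using no that f(2)[of n] unfolding branching_def by (metis is_singletonI' is_singleton_the_elem empty_iff mem_children singletonD)
    define c where "c = \<theta> (f m, f (Suc m))"
    have const: "\<theta> (f n, f (Suc n)) = c" if "n \<ge> m" for n
      using that
    proof (induction rule: dec_induct)
      case (step n)
      then show ?case using unit_flowD(2)[OF \<theta>(1) f(2)[of n]] only[of "Suc n"] by simp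
    qed (simp add: c_def)
    have c: "c > 0" using f(3) by (simp add: c_def)
    have inj: "inj (\<lambda>n. (f (n + m), f (Suc (n + m))))"
    proof (rule injI)
      fix x y assume "(f (x + m), f (Suc (x + m))) = (f (y + m), f (Suc (y + m)))"
      then have "depth (f (x + m)) = depth (f (y + m))" by simp
      then show "x = y" unfolding ray_depth[of f, OF f(1,2)] by simp
    qed
    have "summable (\<lambda>n. l (f (n + m), f (Suc (n + m))))"
    proof (rule summableI_nonneg_bounded)
      show "0 \<le> l (f (n + m), f (Suc (n + m)))" for n using len_pos[OF f(2)] by (simp add: less_imp_le)
      \<comment> \<open>Each edge of the tail carries the flow \<open>c\<close>, hence contributes
        its length times \<open>c\<^sup>2\<close> to the energy.\<close>
      show "(\<Sum>i<n. l (f (i + m), f (Suc (i + m)))) \<le> energy T l \<theta> / c\<^sup>2" for n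
      proof -
        let ?e = "\<lambda>n. (f (n + m), f (Suc (n + m)))"
        have "(\<Sum>i<n. l (?e i)) * c\<^sup>2 = (\<Sum>i<n. l (?e i) * (\<theta> (?e i))\<^sup>2)"
          using const by (simp add: sum_distrib_right)
        also have "\<dots> = (\<Sum>e\<in>?e ` {..<n}. l e * (\<theta> e)\<^sup>2)"
          by (subst sum.reindex) (use inj in \<open>auto intro: inj_on_subset\<close>)
        also have "\<dots> \<le> energy T l \<theta>"
          unfolding energy_def using \<theta>(2) f(2) len_pos unfolding finite_energy_def
          by (intro finite_sum_le_infsum) (auto simp: less_imp_le)
        finally show ?thesis using c by (simp add: field_simps)
      qed
    qed
    then have "summable (\<lambda>n. l (f n, f (Suc n)))"
      using summable_iff_shift[of "\<lambda>n. l (f n, f (Suc n))" m] by simp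
    from ray_branching[OF wc f(2) this, of m] no show False by blast
  qed
  define B where "B = {n. branching T (f n)}"
  have infB: "infinite B" unfolding B_def using branch by (simp add: infinite_nat_iff_unbounded_le)
  have "\<exists>\<tau>. \<tau> \<in> ext_boundary T \<and> f n \<in> path_verts \<tau> \<and> f (Suc n) \<notin> path_verts \<tau>" if n: "n \<in> B" for n
  proof -
    have "branching T (f n)" using n by (simp add: B_def)
    then obtain w where w: "(f n, w) \<in> tedges T" "w \<noteq> f (Suc n)" by (rule branching_other_child)
    have "through T w \<noteq> {}" using through_nonempty edge_verts[OF w(1)] by simp
    then obtain \<tau> where \<tau>: "\<tau> \<in> ext_boundary T" "w \<in> path_verts \<tau>" by (auto simp: through_iff)
    have "f n \<in> path_verts \<tau>" by (rule path_parent(1)[OF \<tau> w(1)])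
    moreover have "f (Suc n) \<notin> path_verts \<tau>" using path_child_unique[OF \<tau>(1,2) _ w(1) f(2)] w(2) by blast
    ultimately show ?thesis using \<tau>(1) by blast
  qed
  then obtain \<tau> where \<tau>: "\<And>n. n \<in> B \<Longrightarrow> \<tau> n \<in> ext_boundary T"
    "\<And>n. n \<in> B \<Longrightarrow> f n \<in> path_verts (\<tau> n)" "\<And>n. n \<in> B \<Longrightarrow> f (Suc n) \<notin> path_verts (\<tau> n)"
    by metis
  \<comment> \<open>The element leaving the ray later still contains the vertex after
    \<open>f n\<close>, which the earlier one avoids.\<close>
  have ne: "\<tau> n \<noteq> \<tau> m" if "n \<in> B" "m \<in> B" "n < m" for n m
  proof -
    have "f (Suc n) \<in> path_verts (\<tau> m)"
      using path_ancestor[OF \<tau>(1)[OF that(2)] ray_reaches[of f, OF f(2)] \<tau>(2)[OF that(2)]] that(3) by simp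
    then show ?thesis using \<tau>(3)[OF that(1)] by auto
  qed
  have "inj_on \<tau> B" by (rule inj_onI) (metis ne linorder_neqE_nat)
  moreover have "\<tau> ` B \<subseteq> ext_boundary T" using \<tau>(1) by auto
  ultimately show ?thesis using infB by (meson finite_imageD finite_subset)
qed

end

section \<open>Visit counts of a factorial-determining sequence\<close>

definition visits :: "(nat \<Rightarrow> 'v tpath) \<Rightarrow> nat \<Rightarrow> 'v \<Rightarrow> nat" where
  "visits \<rho> n v = card {j. j < n \<and> v \<in> path_verts (\<rho> j)}"

lemma visits_0 [simp]: "visits \<rho> 0 v = 0"
  by (simp add: visits_def)

lemma visits_Suc: "visits \<rho> (Suc n) v = visits \<rho> n v + (if v \<in> path_verts (\<rho> n) then 1 else 0)"
proof -
  have "{j. j < Suc n \<and> v \<in> path_verts (\<rho> j)} =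
    (if v \<in> path_verts (\<rho> n) then insert n {j. j < n \<and> v \<in> path_verts (\<rho> j)}
     else {j. j < n \<and> v \<in> path_verts (\<rho> j)})"
    by (auto simp: less_Suc_eq)
  then show ?thesis by (simp add: visits_def)
qed

lemma visits_sum: "real (visits \<rho> n v) = (\<Sum>j<n. if v \<in> path_verts (\<rho> j) then 1 else 0)"
  by (induction n) (simp_all add: visits_Suc)

lemma visits_le: "visits \<rho> n v \<le> n"
  by (induction n) (auto simp: visits_Suc)

text \<open>The successive visits to \<open>v\<close> find 0, 1, 2, ... earlier ones, so the sum
  counts pairs of visits.\<close>

lemma visits_pairs:
  "(\<Sum>k<n. if v \<in> path_verts (\<rho> k) then real (visits \<rho> k v) else 0)
    = real (visits \<rho> n v) * (real (visits \<rho> n v) - 1) / 2"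
  by (induction n) (simp_all add: visits_Suc field_simps)

context tree_network
begin

definition seq_factorial :: "(nat \<Rightarrow> 'v tpath) \<Rightarrow> nat \<Rightarrow> real" where
  "seq_factorial \<rho> n = (\<Sum>j<n. pairing l (\<rho> n) (\<rho> j))"

text \<open>\<open>C\<close> may be any finite set of edges of \<open>\<sigma>\<close> that contains
  the overlaps, because unvisited edges contribute 0. This freedom is needed since
  \<open>\<sigma>\<close> itself may have infinitely many edges.\<close>

lemma pairing_sum:
  assumes \<rho>: "\<And>j. j < n \<Longrightarrow> \<rho> j \<in> ext_boundary T" and \<sigma>: "\<sigma> \<in> ext_boundary T"
    and C: "finite C" "C \<subseteq> path_edges \<sigma>" "\<And>j. j < n \<Longrightarrow> path_edges \<sigma> \<inter> path_edges (\<rho> j) \<subseteq> C"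
  shows "(\<Sum>j<n. pairing l \<sigma> (\<rho> j)) = (\<Sum>e\<in>C. l e * real (visits \<rho> n (snd e)))"
proof -
  have "pairing l \<sigma> (\<rho> j) = (\<Sum>e\<in>C. if snd e \<in> path_verts (\<rho> j) then l e else 0)" if "j < n" for j
  proof -
    have "path_edges \<sigma> \<inter> path_edges (\<rho> j) = {e \<in> C. snd e \<in> path_verts (\<rho> j)}"
      using C(2) C(3)[OF that] by (auto simp: path_edges_eq[OF \<sigma>] path_edges_eq[OF \<rho>[OF that]])
    then show ?thesis unfolding pairing_def using C(1) by (simp add: sum.inter_filter)
  qed
  then have "(\<Sum>j<n. pairing l \<sigma> (\<rho> j)) =
      (\<Sum>j<n. \<Sum>e\<in>C. if snd e \<in> path_verts (\<rho> j) then l e else 0)"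
    by simp
  also have "\<dots> = (\<Sum>e\<in>C. \<Sum>j<n. if snd e \<in> path_verts (\<rho> j) then l e else 0)" by (rule sum.swap)
  also have "\<dots> = (\<Sum>e\<in>C. l e * real (visits \<rho> n (snd e)))"
    unfolding visits_sum sum_distrib_left by (intro sum.cong refl) simp
  finally show ?thesis .
qed

lemma pairing_sum_common:
  assumes \<rho>: "\<And>j. j < n \<Longrightarrow> \<rho> j \<in> ext_boundary T" and \<sigma>: "\<sigma> \<in> ext_boundary T - \<rho> ` {..<n}"
  defines "C \<equiv> \<Union>j<n. path_edges \<sigma> \<inter> path_edges (\<rho> j)"
  shows "finite C" "(\<Sum>j<n. pairing l \<sigma> (\<rho> j)) = (\<Sum>e\<in>C. l e * real (visits \<rho> n (snd e)))"
proof -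
  show fin: "finite C" unfolding C_def 
    using \<rho> \<sigma> by (intro finite_UN_I finite_lessThan finite_common_edges) auto
  show "(\<Sum>j<n. pairing l \<sigma> (\<rho> j)) = (\<Sum>e\<in>C. l e * real (visits \<rho> n (snd e)))"
    by (rule pairing_sum) (use \<rho> \<sigma> fin in \<open>auto simp: C_def\<close>)
qed

lemma pairing_sum_ge:
  assumes \<rho>: "\<And>j. j < n \<Longrightarrow> \<rho> j \<in> ext_boundary T" and \<sigma>: "\<sigma> \<in> ext_boundary T - \<rho> ` {..<n}"
    and F: "finite F" "F \<subseteq> tedges T"
  shows "(\<Sum>e\<in>F. if snd e \<in> path_verts \<sigma> then l e * real (visits \<rho> n (snd e)) else 0)
    \<le> (\<Sum>j<n. pairing l \<sigma> (\<rho> j))"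
proof -
  define C where "C = (\<Union>j<n. path_edges \<sigma> \<inter> path_edges (\<rho> j)) \<union> (F \<inter> path_edges \<sigma>)"
  have sE: "path_edges \<sigma> = {e \<in> tedges T. snd e \<in> path_verts \<sigma>}" using \<sigma> path_edges_eq by simp
  have fin: "finite C" unfolding C_def using pairing_sum_common(1)[OF \<rho> \<sigma>] F(1) by simp
  have "(\<Sum>e\<in>F. if snd e \<in> path_verts \<sigma> then l e * real (visits \<rho> n (snd e)) else 0)
      = (\<Sum>e\<in>F \<inter> path_edges \<sigma>. l e * real (visits \<rho> n (snd e)))"
    using F by (intro sum.mono_neutral_cong_right) (auto simp: sE)
  also have "\<dots> \<le> (\<Sum>e\<in>C. l e * real (visits \<rho> n (snd e)))"
    using fin by (intro sum_mono2) (auto simp: C_def sE len_pos less_imp_le)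
  also have "\<dots> = (\<Sum>j<n. pairing l \<sigma> (\<rho> j))"
    by (rule pairing_sum[symmetric]) (use \<rho> \<sigma> fin in \<open>auto simp: C_def\<close>)
  finally show ?thesis .
qed

lemma factorial_determiningD:
  assumes "factorial_determining T l \<rho>"
  shows "\<rho> n \<in> ext_boundary T" "\<rho> n \<in> ext_boundary T - \<rho> ` {..<n}" "inj \<rho>"
    and "\<And>\<sigma>. \<sigma> \<in> ext_boundary T - \<rho> ` {..<n} \<Longrightarrow> seq_factorial \<rho> n \<le> (\<Sum>j<n. pairing l \<sigma> (\<rho> j))"
proof -
  show "\<rho> n \<in> ext_boundary T" "\<rho> n \<in> ext_boundary T - \<rho> ` {..<n}"
    "\<And>\<sigma>. \<sigma> \<in> ext_boundary T - \<rho> ` {..<n} \<Longrightarrow> seq_factorial \<rho> n \<le> (\<Sum>j<n. pairing l \<sigma> (\<rho> j))"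
    using assms unfolding factorial_determining_def seq_factorial_def by auto
  have "\<rho> i \<noteq> \<rho> j" if "i < j" for i j
    using assms that unfolding factorial_determining_def by (metis Diff_iff imageI lessThan_iff)
  then show "inj \<rho>" by (metis injI linorder_neqE_nat)
qed

text \<open>Double counting: an edge contributes its length once for every pair \<open>j < k\<close>
  of paths that both use it. Restricting to a finite \<open>F\<close> gives the inequality and
  avoids infinite sums.\<close>

lemma sum_seq_factorial_ge:
  assumes fd: "factorial_determining T l \<rho>" and F: "finite F" "F \<subseteq> tedges T"
  shows "(\<Sum>e\<in>F. l e * (real (visits \<rho> n (snd e)) * (real (visits \<rho> n (snd e)) - 1) / 2))
    \<le> (\<Sum>k<n. seq_factorial \<rho> k)"
proof -
  note D = factorial_determiningD[OF fd]
  have "(\<Sum>e\<in>F. l e * (real (visits \<rho> n (snd e)) * (real (visits \<rho> n (snd e)) - 1) / 2))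
    = (\<Sum>e\<in>F. \<Sum>k<n. if snd e \<in> path_verts (\<rho> k) then l e * real (visits \<rho> k (snd e)) else 0)"
    unfolding visits_pairs[symmetric] sum_distrib_left by (intro sum.cong refl) simp
  also have "\<dots> = (\<Sum>k<n. \<Sum>e\<in>F. if snd e \<in> path_verts (\<rho> k) then l e * real (visits \<rho> k (snd e)) else 0)"
    by (rule sum.swap)
  also have "\<dots> \<le> (\<Sum>k<n. seq_factorial \<rho> k)"
    unfolding seq_factorial_def by (intro sum_mono pairing_sum_ge) (use D(1,2) F in auto)
  finally show ?thesis .
qed

lemma pairing_nonneg:
  "\<sigma> \<in> ext_boundary T \<Longrightarrow> 0 \<le> pairing l \<sigma> \<tau>"
  unfolding pairing_def by (intro sum_nonneg) (auto simp: path_edges_eq len_pos less_imp_le)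

text \<open>The later element \<open>\<rho> n\<close> was already an admissible competitor at stage
  \<open>m\<close>, and the additional pairings are nonnegative.\<close>

lemma seq_factorial_mono:
  assumes fd: "factorial_determining T l \<rho>"
  shows "mono (seq_factorial \<rho>)"
proof (rule monoI)
  note D = factorial_determiningD[OF fd]
  fix m n :: nat assume mn: "m \<le> n"
  have "\<rho> n \<in> ext_boundary T - \<rho> ` {..<m}" using D(2)[of n] mn by auto
  then have "seq_factorial \<rho> m \<le> (\<Sum>j<m. pairing l (\<rho> n) (\<rho> j))" by (rule D(4))
  also have "\<dots> \<le> seq_factorial \<rho> n"
    unfolding seq_factorial_def using mn D(1) pairing_nonneg by (intro sum_mono2) auto
  finally show "seq_factorial \<rho> m \<le> seq_factorial \<rho> n" .
qed

lemma visits_root: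
  assumes fd: "factorial_determining T l \<rho>"
  shows "visits \<rho> n (troot T) = n"
  unfolding visits_def using factorial_determiningD(1)[OF fd] root_in_path by simp

lemma visits_children:
  assumes fd: "factorial_determining T l \<rho>" and v: "v \<in> tverts T" "children T v \<noteq> {}"
  shows "visits \<rho> n v = (\<Sum>w\<in>children T v. visits \<rho> n w)"
proof -
  have P: "\<rho> j \<in> ext_boundary T" for j using factorial_determiningD(1)[OF fd] .
  have "{j. j < n \<and> v \<in> path_verts (\<rho> j)} = (\<Union>w\<in>children T v. {j. j < n \<and> w \<in> path_verts (\<rho> j)})"
    using through_children[OF v(2)] P by (auto simp: through_iff set_eq_iff)
  then show ?thesis unfolding visits_def
    using finite_children[OF v(1)] path_child_unique[OF P] by (auto intro!: card_UN_disjoint)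
qed

text \<open>Only one path passes through a childless vertex, and the sequence is injective.\<close>

lemma visits_childless:
  assumes fd: "factorial_determining T l \<rho>" and v: "children T v = {}"
  shows "visits \<rho> n v \<le> 1"
proof -
  note D = factorial_determiningD[OF fd]
  have "i = j" if "v \<in> path_verts (\<rho> i)" "v \<in> path_verts (\<rho> j)" for i j
  proof -
    have "\<rho> i = \<rho> j"
      by (rule through_leaf_unique[OF v]) (use that D(1) in \<open>simp_all add: through_iff\<close>)
    then show ?thesis using D(3) by (simp add: inj_eq)
  qed
  moreover have "finite {j. j < n \<and> v \<in> path_verts (\<rho> j)}" by simp
  ultimately show ?thesis unfolding visits_def One_nat_def by (subst card_le_Suc0_iff_eq) blast+
qed

end

section \<open>Topology and harmonic measure on the boundary\<close>

lemma sets_borel_of_top: "sets (borel_of_top X) = sigma_sets (topspace X) {U. openin X U}"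
  unfolding borel_of_top_def by (rule sets_measure_of) (auto dest: openin_subset)

lemma space_borel_of_top: "space (borel_of_top X) = topspace X"
  unfolding borel_of_top_def by (rule space_measure_of) (auto dest: openin_subset)

lemma openin_sets_borel_of_top: "openin X U \<Longrightarrow> U \<in> sets (borel_of_top X)"
  unfolding sets_borel_of_top by auto

lemma continuous_map_borel_of_top:
  assumes "continuous_map X euclideanreal f"
  shows "f \<in> borel_measurable (borel_of_top X)"
proof (rule borel_measurableI)
  fix S :: "real set" assume "open S"
  then have "openin X {x \<in> topspace X. f x \<in> S}"
    by (intro openin_continuous_map_preimage[OF assms]) simp
  moreover have "f -` S \<inter> space (borel_of_top X) = {x \<in> topspace X. f x \<in> S}"
    by (auto simp: space_borel_of_top)
  ultimately show "f -` S \<inter> space (borel_of_top X) \<in> sets (borel_of_top X)"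
    by (simp add: openin_sets_borel_of_top)
qed

context lf_tree
begin

lemma topspace_ext_boundary: "topspace (ext_boundary_topology T) = ext_boundary T"
  unfolding ext_boundary_topology_def topology_generated_by_topspace
proof
  show "\<Union> (through T ` tverts T) \<subseteq> ext_boundary T" by (auto simp: through_iff)
  show "ext_boundary T \<subseteq> \<Union> (through T ` tverts T)"
    unfolding through_root[symmetric] by (rule Union_upper) (rule imageI, rule root_vert)
qed

lemma openin_through: "v \<in> tverts T \<Longrightarrow> openin (ext_boundary_topology T) (through T v)"
  unfolding ext_boundary_topology_def by (intro topology_generated_by_Basis) auto

text \<open>The sets through two vertices of one path are nested, so for a finite intersection the
  deeper vertex serves.\<close>

lemma openin_contains_through:
  assumes "openin (ext_boundary_topology T) U" "\<sigma> \<in> ext_boundary T" "\<sigma> \<in> U"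
  shows "\<exists>v\<in>path_verts \<sigma>. through T v \<subseteq> U"
proof -
  have "generate_topology_on (through T ` tverts T) U"
    using assms(1) unfolding ext_boundary_topology_def by (simp add: openin_topology_generated_by_iff)
  then show ?thesis using assms(3)
  proof (induction rule: generate_topology_on.induct)
    case (Int a b)
    then obtain u v where u: "u \<in> path_verts \<sigma>" "through T u \<subseteq> a" and v: "v \<in> path_verts \<sigma>" "through T v \<subseteq> b"
      by auto
    show ?case
    proof (cases "depth u \<le> depth v")
      case True
      then have "through T v \<subseteq> through T u"
        by (intro through_subset path_comparable[OF assms(2) u(1) v(1)])
      then show ?thesis using u v by blast
    next
      case False
      then have "through T u \<subseteq> through T v"
        by (intro through_subset path_comparable[OF assms(2) v(1) u(1)]) simp
      then show ?thesis using u v by blast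
    qed
  next
    case (UN K)
    then obtain k where k: "k \<in> K" "\<sigma> \<in> k" by auto
    then obtain v where "v \<in> path_verts \<sigma>" "through T v \<subseteq> k" using UN.IH by blast
    then show ?case using k by blast
  next
    case (Basis s)
    then obtain v where "s = through T v" by auto
    then show ?case using Basis(2) by (auto simp: through_iff)
  qed simp
qed

lemma harmonic_measureD:
  assumes "harmonic_measure T \<eta> \<mu>"
  shows "prob_space \<mu>" "space \<mu> = boundary T"
    and "\<And>v. v \<in> tverts T \<Longrightarrow> through T v \<inter> boundary T \<in> sets \<mu>"
    and "\<And>u v. (u, v) \<in> tedges T \<Longrightarrow> measure \<mu> (through T v \<inter> boundary T) = \<eta> (u, v)"
proof -
  show "prob_space \<mu>" "space \<mu> = boundary T"
    "\<And>u v. (u, v) \<in> tedges T \<Longrightarrow> measure \<mu> (through T v \<inter> boundary T) = \<eta> (u, v)"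
    using assms unfolding harmonic_measure_def by auto
  have "sets \<mu> = sets (borel_of_top (boundary_topology T))"
    using assms unfolding harmonic_measure_def by auto
  moreover have "openin (boundary_topology T) (through T v \<inter> boundary T)" if "v \<in> tverts T" for v
    unfolding boundary_topology_def openin_subtopology using openin_through[OF that] by auto
  ultimately show "through T v \<inter> boundary T \<in> sets \<mu>" if "v \<in> tverts T" for v
    using that unfolding sets_borel_of_top by auto
qed

lemma harmonic_measure_embedding:
  assumes hm: "harmonic_measure T \<eta> \<mu>"
  shows "(\<lambda>x. x) \<in> measurable \<mu> (borel_of_top (ext_boundary_topology T))"
  unfolding borel_of_top_def
proof (rule measurable_measure_of)
  show "{U. openin (ext_boundary_topology T) U} \<subseteq> Pow (topspace (ext_boundary_topology T))"
    by (auto dest: openin_subset)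
  show "(\<lambda>x. x) \<in> space \<mu> \<rightarrow> topspace (ext_boundary_topology T)"
    using harmonic_measureD(2)[OF hm] by (auto simp: topspace_ext_boundary ext_boundary_def)
  fix U assume "U \<in> {U. openin (ext_boundary_topology T) U}"
  then have "openin (boundary_topology T) (U \<inter> boundary T)"
    unfolding boundary_topology_def openin_subtopology by auto
  then have "U \<inter> boundary T \<in> sets \<mu>"
    using hm openin_sets_borel_of_top unfolding harmonic_measure_def by blast
  then show "(\<lambda>x. x) -` U \<inter> space \<mu> \<in> sets \<mu>" using harmonic_measureD(2)[OF hm] by simp
qed

end

section \<open>The upper bound on the factorials\<close>

context tree_network
begin

text \<open>
  When \<open>\<sigma>\<close> is already in the sequence, it is not an admissible competitor; but if it has finite
  length, weak completeness provides branches leaving \<open>\<sigma>\<close> beyond all the other paths.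
\<close>

lemma seq_factorial_le_ray:
  assumes fd: "factorial_determining T l \<rho>" and wc: "weakly_complete T l" and \<sigma>: "\<sigma> \<in> boundary T"
    and B: "\<And>F. finite F \<Longrightarrow> F \<subseteq> path_edges \<sigma> \<Longrightarrow> (\<Sum>e\<in>F. l e * real (visits \<rho> k (snd e))) \<le> B"
  shows "seq_factorial \<rho> k \<le> B"
proof -
  note D = factorial_determiningD[OF fd]
  have \<sigma>P: "\<sigma> \<in> ext_boundary T" using \<sigma> by (simp add: ext_boundary_def)
  have "\<exists>\<tau>\<in>ext_boundary T - \<rho> ` {..<k}. \<forall>j<k. path_edges \<tau> \<inter> path_edges (\<rho> j) \<subseteq> path_edges \<sigma>"
  proof (cases "\<sigma> \<in> \<rho> ` {..<k}")
    case False
    then show ?thesis using \<sigma>P by (intro bexI[of _ \<sigma>]) auto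
  next
    case True
    then obtain i where i: "i < k" "\<sigma> = \<rho> i" by auto
    obtain f where f: "\<sigma> = InfPath f" "f 0 = troot T" "\<And>n. (f n, f (Suc n)) \<in> tedges T"
      using \<sigma> by (auto simp: boundary_def)
    let ?e = "\<lambda>n. (f n, f (Suc n))"
    have on: "f n \<in> path_verts \<sigma>" for n using f(1) by simp
    have inj: "inj ?e"
    proof (rule injI)
      fix x y assume "?e x = ?e y"
      then have "depth (f x) = depth (f y)" by simp
      then show "x = y" unfolding ray_depth[of f, OF f(2,3)] .
    qed
    \<comment> \<open>Since \<open>\<sigma>\<close> is \<open>\<rho> i\<close>, each of its edges
      has been visited at least once, so \<open>B\<close> also bounds the length of
      \<open>\<sigma>\<close>.\<close>
    have "summable (\<lambda>n. l (?e n))"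
    proof (rule summableI_nonneg_bounded)
      show "0 \<le> l (?e n)" for n using len_pos[OF f(3)] by (simp add: less_imp_le)
      show "(\<Sum>n<m. l (?e n)) \<le> B" for m
      proof -
        have "(\<Sum>n<m. l (?e n)) = (\<Sum>e\<in>?e ` {..<m}. l e)"
          by (subst sum.reindex) (use inj in \<open>auto intro: inj_on_subset\<close>)
        also have "\<dots> \<le> (\<Sum>e\<in>?e ` {..<m}. l e * real (visits \<rho> k (snd e)))"
        proof (rule sum_mono)
          fix e assume e: "e \<in> ?e ` {..<m}"
          have "visits \<rho> k (snd e) \<noteq> 0"
            unfolding visits_def using i on e by auto
          then have "1 \<le> real (visits \<rho> k (snd e))" by simp
          moreover have "0 < l e" using e f(3) len_pos by auto
          ultimately show "l e \<le> l e * real (visits \<rho> k (snd e))" by simp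
        qed
        also have "\<dots> \<le> B" by (rule B) (auto simp: f(1))
        finally show ?thesis .
      qed
    qed
    \<comment> \<open>The sum is a crude bound for all separation depths. Terms with
      \<open>\<rho> j = \<sigma>\<close> have an unspecified value, which only pushes the threshold
      further out.\<close>
    then obtain n where n: "n > (\<Sum>j<k. meet_depth \<sigma> (\<rho> j))" "branching T (f n)"
      using ray_branching[of f, OF wc f(3)] by (meson Suc_le_lessD)
    have far: "f n \<notin> path_verts (\<rho> j)" if "j < k" "\<rho> j \<noteq> \<sigma>" for j
    proof
      assume "f n \<in> path_verts (\<rho> j)"
      then have "n \<le> meet_depth \<sigma> (\<rho> j)"
        using mem_common_iff[OF \<sigma>P D(1) that(2)[symmetric] on] ray_depth[of f, OF f(2,3)] by simp
      also have "\<dots> \<le> (\<Sum>j<k. meet_depth \<sigma> (\<rho> j))" using that(1) by (intro member_le_sum) auto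
      finally show False using n by simp
    qed
    obtain w where w: "(f n, w) \<in> tedges T" "w \<noteq> f (Suc n)"
      by (rule branching_other_child[OF n(2)])
    have "through T w \<noteq> {}" using through_nonempty edge_verts[OF w(1)] by simp
    then obtain \<tau> where \<tau>: "\<tau> \<in> ext_boundary T" "w \<in> path_verts \<tau>" by (auto simp: through_iff)
    have fn: "f n \<in> path_verts \<tau>" using path_parent(1)[OF \<tau> w(1)] .
    have "w \<notin> path_verts \<sigma>" using path_child_unique[OF \<sigma>P _ on w(1) f(3)] w(2) by blast
    then have "\<tau> \<noteq> \<rho> j" if "j < k" for j using far[OF that] fn \<tau>(2) by (cases "\<rho> j = \<sigma>") auto
    moreover have "path_edges \<tau> \<inter> path_edges (\<rho> j) \<subseteq> path_edges \<sigma>" if "j < k" for j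
    proof (cases "\<rho> j = \<sigma>")
      case False
      show ?thesis
      proof
        fix e assume "e \<in> path_edges \<tau> \<inter> path_edges (\<rho> j)"
        then have e: "snd e \<in> path_verts \<tau>" "snd e \<in> path_verts (\<rho> j)" "e \<in> tedges T"
          by (auto simp: path_edges_eq \<tau> D(1))
        have "(f n, snd e) \<notin> (tedges T)\<^sup>*"
          using far[OF that False] path_ancestor[OF D(1) _ e(2)] by blast
        then have "(snd e, f n) \<in> (tedges T)\<^sup>*"
          using path_comparable[OF \<tau>(1)] fn e(1) nat_le_linear by blast
        then show "e \<in> path_edges \<sigma>"
          using path_ancestor[OF \<sigma>P _ on] e(3) by (simp add: path_edges_eq[OF \<sigma>P])
      qed
    qed simp
    ultimately show ?thesis using \<tau>(1) by (intro bexI[of _ \<tau>]) auto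
  qed
  then obtain \<tau> where \<tau>: "\<tau> \<in> ext_boundary T - \<rho> ` {..<k}"
    "\<And>j. j < k \<Longrightarrow> path_edges \<tau> \<inter> path_edges (\<rho> j) \<subseteq> path_edges \<sigma>" by blast
  have "seq_factorial \<rho> k \<le> (\<Sum>j<k. pairing l \<tau> (\<rho> j))" by (rule D(4)[OF \<tau>(1)])
  also have "\<dots> = (\<Sum>e\<in>(\<Union>j<k. path_edges \<tau> \<inter> path_edges (\<rho> j)). l e * real (visits \<rho> k (snd e)))"
    by (rule pairing_sum_common(2)[OF D(1) \<tau>(1)])
  also have "\<dots> \<le> B"
    using \<tau>(2) by (intro B pairing_sum_common(1)[OF D(1) \<tau>(1)]) auto
  finally show ?thesis .
qed

text \<open>All edges of \<open>F\<close> lie above the deepest head in \<open>F\<close>, so the sum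
  is at most the potential there.\<close>

lemma path_potential_le:
  assumes cf: "unit_current_flow T l \<eta>" and \<sigma>: "\<sigma> \<in> ext_boundary T"
    and F: "finite F" "F \<subseteq> path_edges \<sigma>"
  shows "(\<Sum>e\<in>F. l e * \<eta> e) \<le> energy T l \<eta>"
proof (cases "F = {}")
  case True
  then show ?thesis by (simp add: energy_nonneg)
next
  case False
  note sE = path_edges_eq[OF \<sigma>]
  obtain e where e: "e \<in> F" "depth (snd e) = Max ((\<lambda>e. depth (snd e)) ` F)"
    using obtains_MAX[OF F(1) False, of "\<lambda>e. depth (snd e)"] by metis
  have v: "snd e \<in> tverts T" using e F sE edge_verts[of "fst e" "snd e"] by auto
  have "F \<subseteq> above (snd e)"
  proof
    fix d assume d: "d \<in> F"
    then have le: "depth (snd d) \<le> depth (snd e)" unfolding e(2) using F(1) by (intro Max_ge) auto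
    have "d \<in> tedges T" "snd d \<in> path_verts \<sigma>" "snd e \<in> path_verts \<sigma>" using d e(1) F(2) sE by auto
    then show "d \<in> above (snd e)" using path_comparable[OF \<sigma> _ _ le] by (simp add: above_def)
  qed
  then have "(\<Sum>e\<in>F. l e * \<eta> e) \<le> potential \<eta> (snd e)"
    unfolding potential_def using finite_above[OF v] cf len_pos
    by (intro sum_mono2) (auto simp: above_def unit_current_flow_def unit_flow_def less_imp_le)
  also have "\<dots> \<le> energy T l \<eta>" by (rule potential_le_energy[OF cf v])
  finally show ?thesis .
qed

lemma seq_factorial_le:
  assumes fd: "factorial_determining T l \<rho>" and wc: "weakly_complete T l"
    and cf: "unit_current_flow T l \<eta>" and hm: "harmonic_measure T \<eta> \<mu>"
  shows "seq_factorial \<rho> k \<le> real k * energy T l \<eta>"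
proof -
  note D = factorial_determiningD[OF fd] and H = harmonic_measureD[OF hm]
  interpret prob_space \<mu> by (rule H(1))
  define W where "W = energy T l \<eta>"
  define E where "E m = {e \<in> tedges T. depth (snd e) \<le> m}" for m
  define h where "h e = l e * real (visits \<rho> k (snd e))" for e
  have h0: "0 \<le> h e" if "e \<in> tedges T" for e using len_pos[OF that] by (simp add: h_def)
  have E: "finite (E m)" "E m \<subseteq> tedges T" "\<And>e. e \<in> E m \<Longrightarrow> snd e \<in> tverts T" for m
    unfolding E_def using finite_edges_depth_le edge_verts by auto
  \<comment> \<open>The part up to depth \<open>m\<close> of the total overlap of
    \<open>\<sigma>\<close> with the first \<open>k\<close> paths. The supremum over
    \<open>m\<close> includes the self-overlap of a ray already used, which may be infinite.\<close>
  define g where "g m \<sigma> = (\<Sum>e\<in>E m. ennreal (h e) * indicator (through T (snd e) \<inter> boundary T) \<sigma>)" for m \<sigma>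
  \<comment> \<open>An infinite supremum leaves nothing to prove; a finite one is a bound
    \<open>B\<close> as required by \<open>seq_factorial_le_ray\<close>.\<close>
  have le: "ennreal (seq_factorial \<rho> k) \<le> (SUP m. g m \<sigma>)" if \<sigma>: "\<sigma> \<in> boundary T" for \<sigma>
  proof (rule ccontr)
    assume not_le: "\<not> ?thesis"
    then have "(SUP m. g m \<sigma>) \<noteq> \<top>" using top_greatest[of "ennreal (seq_factorial \<rho> k)"] by metis
    then obtain B where B: "(SUP m. g m \<sigma>) = ennreal B" "0 \<le> B"
      by (cases "(SUP m. g m \<sigma>)" rule: ennreal_cases) auto
    have \<sigma>P: "\<sigma> \<in> ext_boundary T" using \<sigma> by (simp add: ext_boundary_def)
    have "seq_factorial \<rho> k \<le> B"
    proof (rule seq_factorial_le_ray[OF fd wc \<sigma>])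
      fix F assume F: "finite F" "F \<subseteq> path_edges \<sigma>"
      define m where "m = Max ((\<lambda>e. depth (snd e)) ` F)"
      have "depth (snd e) \<le> m" if "e \<in> F" for e
        unfolding m_def using F(1) that by (intro Max_ge) auto
      then have FE: "F \<subseteq> E m" using F(2) by (auto simp: E_def path_edges_eq[OF \<sigma>P])
      have "ennreal (\<Sum>e\<in>F. h e) = (\<Sum>e\<in>F. ennreal (h e))"
        using F h0 by (intro sum_ennreal[symmetric]) (auto simp: path_edges_eq[OF \<sigma>P])
      also have "\<dots> = (\<Sum>e\<in>F. ennreal (h e) * indicator (through T (snd e) \<inter> boundary T) \<sigma>)"
        using F \<sigma> \<sigma>P by (intro sum.cong) (auto simp: path_edges_eq[OF \<sigma>P] through_iff indicator_def)
      also have "\<dots> \<le> g m \<sigma>" unfolding g_def using E(1) FE by (intro sum_mono2) auto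
      also have "\<dots> \<le> ennreal B" unfolding B(1)[symmetric] by (rule SUP_upper) simp
      finally show "(\<Sum>e\<in>F. l e * real (visits \<rho> k (snd e))) \<le> B"
        using B(2) by (simp add: h_def)
    qed
    then show False using not_le B by (simp add: ennreal_leI)
  qed
  have meas [measurable]: "g m \<in> borel_measurable \<mu>" for m
    unfolding g_def using H(3) E(3)
    by (intro borel_measurable_sum borel_measurable_times_ennreal borel_measurable_indicator) auto
  have int_g: "(\<integral>\<^sup>+\<sigma>. g m \<sigma> \<partial>\<mu>) \<le> ennreal (real k * W)" for m
  proof -
    have "(\<integral>\<^sup>+\<sigma>. g m \<sigma> \<partial>\<mu>) = (\<Sum>e\<in>E m. ennreal (h e) * emeasure \<mu> (through T (snd e) \<inter> boundary T))"
      unfolding g_def using H(3) E(3)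
      by (subst nn_integral_sum) (auto intro!: sum.cong nn_integral_cmult_indicator)
    also have "\<dots> = (\<Sum>e\<in>E m. ennreal (h e * \<eta> e))"
    proof (rule sum.cong[OF refl])
      fix e assume "e \<in> E m"
      then have e: "e \<in> tedges T" using E by auto
      then have "measure \<mu> (through T (snd e) \<inter> boundary T) = \<eta> e" using H(4)[of "fst e" "snd e"] by simp
      then show "ennreal (h e) * emeasure \<mu> (through T (snd e) \<inter> boundary T) = ennreal (h e * \<eta> e)"
        using h0[OF e] measure_nonneg by (simp add: emeasure_eq_measure ennreal_mult')
    qed
    also have "\<dots> = ennreal (\<Sum>e\<in>E m. h e * \<eta> e)"
    proof (rule sum_ennreal)
      fix e assume "e \<in> E m"
      then have e: "e \<in> tedges T" using E(2) by auto
      have "0 \<le> \<eta> e" using cf e by (simp add: unit_current_flow_def unit_flow_def)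
      then show "0 \<le> h e * \<eta> e" using h0[OF e] by simp
    qed
    also have "\<dots> \<le> ennreal (real k * W)"
    proof (rule ennreal_leI)
      \<comment> \<open>Regrouping by the visiting path turns the sum into truncated potentials of
        \<open>\<rho> j\<close>, each at most \<open>W\<close>.\<close>
      have "(\<Sum>e\<in>E m. h e * \<eta> e) = (\<Sum>e\<in>E m. \<Sum>j<k. if snd e \<in> path_verts (\<rho> j) then l e * \<eta> e else 0)"
        unfolding h_def visits_sum sum_distrib_left sum_distrib_right by (intro sum.cong refl) simp
      also have "\<dots> = (\<Sum>j<k. \<Sum>e\<in>E m. if snd e \<in> path_verts (\<rho> j) then l e * \<eta> e else 0)"
        by (rule sum.swap)
      also have "\<dots> = (\<Sum>j<k. \<Sum>e\<in>{e \<in> E m. snd e \<in> path_verts (\<rho> j)}. l e * \<eta> e)"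
        using E(1) by (simp add: sum.inter_filter)
      also have "\<dots> \<le> (\<Sum>j<k. W)"
        unfolding W_def using E
        by (intro sum_mono path_potential_le[OF cf D(1)]) (auto simp: path_edges_eq[OF D(1)])
      finally show "(\<Sum>e\<in>E m. h e * \<eta> e) \<le> real k * W" by simp
    qed
    finally show ?thesis .
  qed
  have "ennreal (seq_factorial \<rho> k) = (\<integral>\<^sup>+\<sigma>. ennreal (seq_factorial \<rho> k) \<partial>\<mu>)"
    by (simp add: emeasure_space_1)
  also have "\<dots> \<le> (\<integral>\<^sup>+\<sigma>. (SUP m. g m \<sigma>) \<partial>\<mu>)"
    by (intro nn_integral_mono) (use le H(2) in auto)
  also have "\<dots> = (SUP m. (\<integral>\<^sup>+\<sigma>. g m \<sigma> \<partial>\<mu>))"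
  proof (rule nn_integral_monotone_convergence_SUP)
    show "incseq g"
      unfolding g_def by (intro incseq_SucI le_funI sum_mono2 E(1)) (auto simp: E_def)
  qed simp
  also have "\<dots> \<le> ennreal (real k * W)" by (rule SUP_least) (rule int_g)
  finally show ?thesis using energy_nonneg by (simp add: W_def)
qed

end

section \<open>Convergence of the visit frequencies\<close>

text \<open>The sum up to \<open>m\<close> is split before its last \<open>q\<close> terms: the
  initial part is bounded by \<open>up\<close>, and each of the last \<open>q\<close> terms by
  \<open>a m\<close>. A small \<open>a m\<close> would then contradict \<open>low\<close>.\<close>

lemma linear_growth_from_sums:
  fixes a :: "nat \<Rightarrow> real"
  assumes mono: "mono a" and W: "0 \<le> W" and up: "\<And>k. a k \<le> real k * W"
    and low: "\<And>e. 0 < e \<Longrightarrow> \<forall>\<^sub>F n in sequentially. (W - e) * (real n)\<^sup>2 / 2 \<le> (\<Sum>k<n. a k)"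
  shows "(\<lambda>n. a n / real n) \<longlonglongrightarrow> W"
proof (rule order_tendstoI)
  fix y assume "W < y"
  have "a n / real n \<le> W" if "n > 0" for n
    using up[of n] that by (simp add: divide_le_eq mult.commute)
  then have "a n / real n < y" if "n > 0" for n
    using \<open>W < y\<close> that by (meson le_less_trans)
  then show "\<forall>\<^sub>F n in sequentially. a n / real n < y"
    by (auto intro: eventually_sequentiallyI[of 1])
next
  fix y assume "y < W"
  define \<epsilon> where "\<epsilon> = W - y"
  have \<epsilon>: "0 < \<epsilon>" using \<open>y < W\<close> by (simp add: \<epsilon>_def)
  \<comment> \<open>Chosen to give \<open>W * \<delta> \<le> \<epsilon> / 2\<close>;
    \<open>W + 1\<close> avoids division by zero when \<open>W = 0\<close>.\<close>
  define \<delta> where "\<delta> = min 1 (\<epsilon> / (2 * (W + 1)))"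
  have \<delta>: "0 < \<delta>" "\<delta> \<le> 1" using \<epsilon> W by (auto simp: \<delta>_def)
  have W\<delta>: "W * \<delta> \<le> \<epsilon> / 2"
  proof -
    have "W * \<delta> \<le> (W + 1) * (\<epsilon> / (2 * (W + 1)))" using W \<delta> by (intro mult_mono) (auto simp: \<delta>_def)
    also have "\<dots> = \<epsilon> / 2" using W by (simp add: field_simps)
    finally show ?thesis .
  qed
  have sum_id: "(\<Sum>k<p. real k * W) \<le> W * (real p)\<^sup>2 / 2" for p
    using W by (induction p) (auto simp: power2_eq_square field_simps)
  have "\<forall>\<^sub>F n in sequentially. (W - \<epsilon> * \<delta> / 4) * (real n)\<^sup>2 / 2 \<le> (\<Sum>k<n. a k)"
    using low \<epsilon> \<delta> by simp
  then show "\<forall>\<^sub>F n in sequentially. y < a n / real n"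
    using eventually_ge_at_top[of "nat \<lceil>2 / \<delta>\<rceil>"] eventually_gt_at_top[of 0]
  proof eventually_elim
    case (elim m)
    \<comment> \<open>The block length lies between \<open>\<delta> * m / 2\<close> and
      \<open>\<delta> * m\<close>; rounding up respects the upper bound once
      \<open>m \<ge> 2 / \<delta>\<close>. After division by \<open>q\<close>, the quadratic term
      and the error in \<open>low\<close> each cost at most
      \<open>\<epsilon> * m / 4\<close>.\<close>
    define q where "q = nat \<lceil>\<delta> * real m / 2\<rceil>"
    have pos: "0 < \<delta> * real m / 2" using \<delta> elim by simp
    have q1: "\<delta> * real m / 2 \<le> real q" unfolding q_def by linarith
    have "2 / \<delta> \<le> real m" using elim(2) by linarith
    then have "2 \<le> \<delta> * real m" using \<delta> by (simp add: field_simps)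
    then have q2: "real q \<le> \<delta> * real m" unfolding q_def using pos by linarith
    also have "\<dots> \<le> real m" using \<delta> elim(3) by (simp add: mult_left_le_one_le)
    finally have qm: "q \<le> m" by simp
    have q0: "0 < real q" using q1 pos by linarith
    have "(\<Sum>k<m. a k) = (\<Sum>k<m - q. a k) + (\<Sum>k\<in>{m - q..<m}. a k)"
      by (metis diff_le_self lessThan_atLeast0 sum.atLeastLessThan_concat zero_le)
    also have "(\<Sum>k<m - q. a k) \<le> (\<Sum>k<m - q. real k * W)" by (intro sum_mono up)
    also have "\<dots> \<le> W * (real (m - q))\<^sup>2 / 2" by (rule sum_id)
    also have "(\<Sum>k\<in>{m - q..<m}. a k) \<le> (\<Sum>k\<in>{m - q..<m}. a m)"
      by (intro sum_mono monoD[OF mono]) auto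
    also have "\<dots> = real q * a m" using qm by simp
    finally have "(W - \<epsilon> * \<delta> / 4) * (real m)\<^sup>2 / 2 \<le> W * (real m - real q)\<^sup>2 / 2 + real q * a m"
      using elim(1) qm by simp
    moreover have "W * (real m - real q)\<^sup>2 / 2 = W * (real m)\<^sup>2 / 2 - real q * (W * real m) + W * (real q)\<^sup>2 / 2"
      by (simp add: power2_eq_square field_simps)
    moreover have "(W - \<epsilon> * \<delta> / 4) * (real m)\<^sup>2 / 2 = W * (real m)\<^sup>2 / 2 - \<epsilon> * \<delta> * (real m)\<^sup>2 / 8"
      by (simp add: field_simps)
    ultimately have 1: "real q * (W * real m) \<le> W * (real q)\<^sup>2 / 2 + \<epsilon> * \<delta> * (real m)\<^sup>2 / 8 + real q * a m"
      by linarith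
    have 2: "W * (real q)\<^sup>2 / 2 \<le> real q * (\<epsilon> * real m / 4)"
    proof -
      have "W * real q \<le> W * (\<delta> * real m)" using q2 W by (intro mult_left_mono)
      also have "\<dots> \<le> \<epsilon> / 2 * real m" using mult_right_mono[OF W\<delta>, of "real m"] by (simp add: mult.assoc)
      finally have "real q * (W * real q) \<le> real q * (\<epsilon> / 2 * real m)" by (intro mult_left_mono) auto
      then show ?thesis by (simp add: power2_eq_square algebra_simps)
    qed
    have 3: "\<epsilon> * \<delta> * (real m)\<^sup>2 / 8 \<le> real q * (\<epsilon> * real m / 4)"
    proof -
      have "(\<delta> * real m / 2) * (\<epsilon> * real m / 4) \<le> real q * (\<epsilon> * real m / 4)"
        using q1 \<epsilon> by (intro mult_right_mono) auto
      then show ?thesis by (simp add: power2_eq_square algebra_simps)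
    qed
    have "real q * (W * real m) \<le> real q * (\<epsilon> * real m / 4) + real q * (\<epsilon> * real m / 4) + real q * a m"
      using 1 2 3 by linarith
    also have "\<dots> = real q * (\<epsilon> * real m / 2 + a m)" by (simp add: algebra_simps)
    finally have "W * real m \<le> \<epsilon> * real m / 2 + a m" using q0 by simp
    moreover have "0 < \<epsilon> * real m" using \<epsilon> elim(3) by simp
    ultimately have "(W - \<epsilon>) * real m < a m" by (simp add: algebra_simps)
    then show ?case using elim(3) by (simp add: \<epsilon>_def less_divide_eq)
  qed
qed

lemma not_tendsto_subseq:
  fixes x :: "nat \<Rightarrow> 'a::metric_space"
  assumes "\<not> x \<longlonglongrightarrow> L"
  obtains r e where "strict_mono (r :: nat \<Rightarrow> nat)" "e > 0" "\<And>n. e \<le> dist (x (r n)) L"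
proof -
  obtain e where e: "e > 0" "\<exists>\<^sub>\<infinity>n. e \<le> dist (x n) L"
    using assms unfolding tendsto_iff by (auto simp: not_eventually not_less frequently_cofinite cofinite_eq_sequentially)
  define A where "A = {n. e \<le> dist (x n) L}"
  have "infinite A" using e(2) by (simp add: A_def frequently_cofinite)
  then have "strict_mono (enumerate A)" "\<And>n. enumerate A n \<in> A"
    by (auto intro: strict_mono_enumerate enumerate_in_set)
  then show thesis using that e(1) by (auto simp: A_def)
qed

context tree_network
begin

text \<open>The count of pairs divided by \<open>n\<^sup>2 / 2\<close>. The shift by
  \<open>1 / n\<close> comes from not pairing a visit with itself and vanishes in the limit.\<close>

lemma visits_energy_le:
  assumes fd: "factorial_determining T l \<rho>" and F: "finite F" "F \<subseteq> tedges T"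
    and up: "\<And>k. seq_factorial \<rho> k \<le> real k * W" and n: "n > 0" and W: "0 \<le> W"
  shows "(\<Sum>e\<in>F. l e * ((visits \<rho> n (snd e) / real n) * (visits \<rho> n (snd e) / real n - 1 / real n))) \<le> W"
proof -
  have "(\<Sum>k<n. real k * W) = real n * (real n - 1) / 2 * W"
    by (induction n) (auto simp: field_simps)
  then have "(\<Sum>e\<in>F. l e * (real (visits \<rho> n (snd e)) * (real (visits \<rho> n (snd e)) - 1) / 2))
    \<le> real n * (real n - 1) / 2 * W"
    using sum_seq_factorial_ge[OF fd F, of n] sum_mono[of "{..<n}" "seq_factorial \<rho>" "\<lambda>k. real k * W"] up
    by simp
  also have "\<dots> \<le> (real n)\<^sup>2 / 2 * W"
    using W by (intro mult_right_mono) (auto simp: power2_eq_square algebra_simps)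
  finally have "2 / (real n)\<^sup>2 * (\<Sum>e\<in>F. l e * (real (visits \<rho> n (snd e)) * (real (visits \<rho> n (snd e)) - 1) / 2)) \<le> W"
    using n by (simp add: field_simps)
  also have "2 / (real n)\<^sup>2 * (\<Sum>e\<in>F. l e * (real (visits \<rho> n (snd e)) * (real (visits \<rho> n (snd e)) - 1) / 2))
    = (\<Sum>e\<in>F. l e * ((visits \<rho> n (snd e) / real n) * (visits \<rho> n (snd e) / real n - 1 / real n)))"
    unfolding sum_distrib_left using n
    by (intro sum.cong refl) (simp add: power2_eq_square field_simps)
  finally show ?thesis .
qed

lemma visits_subseq_limit:
  assumes fd: "factorial_determining T l \<rho>" and cf: "unit_current_flow T l \<eta>"
    and up: "\<And>k. seq_factorial \<rho> k \<le> real k * energy T l \<eta>"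
    and s: "strict_mono (s :: nat \<Rightarrow> nat)"
    and lim: "\<And>e. e \<in> tedges T \<Longrightarrow> (\<lambda>m. visits \<rho> (s m) (snd e) / real (s m)) \<longlonglongrightarrow> \<theta> e"
    and e: "e \<in> tedges T"
  shows "\<theta> e = \<eta> e"
proof -
  define W where "W = energy T l \<eta>"
  have s_pos: "\<forall>\<^sub>F m in sequentially. s m > 0"
    by (rule eventually_sequentiallyI[of 1]) (use seq_suble[OF s] in \<open>metis less_le_trans zero_less_one\<close>)
  have s_inv: "(\<lambda>m. 1 / real (s m)) \<longlonglongrightarrow> 0"
    using LIMSEQ_subseq_LIMSEQ[OF lim_1_over_n s] by (simp add: o_def)
  have flow: "unit_flow T \<theta>"
    unfolding unit_flow_def
  proof (intro conjI ballI)
    show "0 \<le> \<theta> e" if "e \<in> tedges T" for e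
      by (rule LIMSEQ_le_const[OF lim[OF that]]) auto
    have sum_lim: "(\<lambda>m. (\<Sum>w\<in>children T v. visits \<rho> (s m) w) / real (s m)) \<longlonglongrightarrow> (\<Sum>w\<in>children T v. \<theta> (v, w))" for v
    proof -
      have "(\<lambda>m. \<Sum>w\<in>children T v. visits \<rho> (s m) w / real (s m)) \<longlonglongrightarrow> (\<Sum>w\<in>children T v. \<theta> (v, w))"
        by (intro tendsto_sum) (use lim[of "(v, _)"] in auto)
      then show ?thesis by (simp add: sum_divide_distrib)
    qed
    have "(\<lambda>m. (\<Sum>w\<in>children T (troot T). visits \<rho> (s m) w) / real (s m)) \<longlonglongrightarrow> 1"
    proof (rule tendsto_eventually)
      show "\<forall>\<^sub>F m in sequentially. (\<Sum>w\<in>children T (troot T). visits \<rho> (s m) w) / real (s m) = 1"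
        using s_pos
        by eventually_elim (use visits_children[OF fd root_vert root_children] visits_root[OF fd] in simp)
    qed
    then show "(\<Sum>v\<in>children T (troot T). \<theta> (troot T, v)) = 1"
      using LIMSEQ_unique sum_lim by blast
    show "case e of (u, v) \<Rightarrow> \<theta> (u, v) = (\<Sum>w\<in>children T v. \<theta> (v, w))" if "e \<in> tedges T" for e
    proof -
      obtain u v where uv: "e = (u, v)" by (cases e)
      have uvE: "(u, v) \<in> tedges T" and v: "v \<in> tverts T" using that uv edge_verts by auto
      have lim_v: "(\<lambda>m. visits \<rho> (s m) v / real (s m)) \<longlonglongrightarrow> \<theta> (u, v)" using lim[OF uvE] by simp
      have "\<theta> (u, v) = (\<Sum>w\<in>children T v. \<theta> (v, w))"
      proof (cases "children T v = {}")
        case False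
        have "(\<lambda>m. (\<Sum>w\<in>children T v. visits \<rho> (s m) w) / real (s m)) \<longlonglongrightarrow> \<theta> (u, v)"
          using lim_v visits_children[OF fd v False] by simp
        then show ?thesis using LIMSEQ_unique sum_lim by blast
      next
        \<comment> \<open>At a childless vertex the outflow is an empty sum, and at most one visit
          makes the frequency tend to 0 as well.\<close>
        case True
        have "(\<lambda>m. visits \<rho> (s m) v / real (s m)) \<longlonglongrightarrow> 0"
        proof (rule tendsto_sandwich[OF _ _ tendsto_const s_inv])
          show "\<forall>\<^sub>F m in sequentially. visits \<rho> (s m) v / real (s m) \<le> 1 / real (s m)"
            using visits_childless[OF fd True] by (auto intro!: always_eventually divide_right_mono)
        qed auto
        then show ?thesis using LIMSEQ_unique lim_v True by force
      qed
      then show ?thesis by (simp add: uv)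
    qed
  qed
  \<comment> \<open>Lower semicontinuity of the energy: the limit is taken on each finite edge set
    separately.\<close>
  have fin: "(\<Sum>e\<in>F. l e * (\<theta> e)\<^sup>2) \<le> W" if F: "finite F" "F \<subseteq> tedges T" for F
  proof (rule tendsto_upperbound)
    show "(\<lambda>m. \<Sum>e\<in>F. l e * ((visits \<rho> (s m) (snd e) / real (s m)) * (visits \<rho> (s m) (snd e) / real (s m) - 1 / real (s m))))
      \<longlonglongrightarrow> (\<Sum>e\<in>F. l e * (\<theta> e)\<^sup>2)"
    proof (rule tendsto_sum)
      fix e assume "e \<in> F"
      then have "(\<lambda>m. visits \<rho> (s m) (snd e) / real (s m)) \<longlonglongrightarrow> \<theta> e" using lim F by blast
      then have "(\<lambda>m. l e * ((visits \<rho> (s m) (snd e) / real (s m)) * (visits \<rho> (s m) (snd e) / real (s m) - 1 / real (s m))))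
        \<longlonglongrightarrow> l e * (\<theta> e * (\<theta> e - 0))"
        by (intro tendsto_intros s_inv)
      then show "(\<lambda>m. l e * ((visits \<rho> (s m) (snd e) / real (s m)) * (visits \<rho> (s m) (snd e) / real (s m) - 1 / real (s m))))
        \<longlonglongrightarrow> l e * (\<theta> e)\<^sup>2"
        by (simp add: power2_eq_square)
    qed
    show "\<forall>\<^sub>F m in sequentially. (\<Sum>e\<in>F. l e * ((visits \<rho> (s m) (snd e) / real (s m)) * (visits \<rho> (s m) (snd e) / real (s m) - 1 / real (s m)))) \<le> W"
      using s_pos
    proof eventually_elim
      case (elim m)
      then show ?case using visits_energy_le[OF fd F up _ energy_nonneg] by (simp add: W_def)
    qed
  qed simp
  have sum: "(\<lambda>e. l e * (\<theta> e)\<^sup>2) summable_on tedges T"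
    using fin len_pos by (intro nonneg_bdd_above_summable_on bdd_aboveI[of _ W]) (auto simp: less_imp_le)
  have "finite_energy T l \<theta>" using sum by (simp add: finite_energy_def)
  moreover have "energy T l \<theta> \<le> energy T l \<eta>"
    unfolding energy_def[of T l \<theta>] using fin by (intro infsum_le_finite_sums[OF sum]) (simp add: W_def)
  ultimately show ?thesis using current_flow_unique[OF cf flow] e by blast
qed

text \<open>Compactness: frequencies lie in \<open>[0, 1]\<close> and there are countably many
  edges, so a diagonal subsequence of any bad subsequence converges at all edges at once, and its
  limit is \<eta>.\<close>

lemma visits_limit:
  assumes fd: "factorial_determining T l \<rho>" and cf: "unit_current_flow T l \<eta>"
    and up: "\<And>k. seq_factorial \<rho> k \<le> real k * energy T l \<eta>" and e: "e \<in> tedges T"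
  shows "(\<lambda>n. visits \<rho> n (snd e) / real n) \<longlonglongrightarrow> \<eta> e"
proof (rule ccontr)
  assume "\<not> ?thesis"
  then obtain r \<epsilon> where r: "strict_mono (r :: nat \<Rightarrow> nat)" "\<epsilon> > 0"
    "\<And>n. \<epsilon> \<le> dist (visits \<rho> (r n) (snd e) / real (r n)) (\<eta> e)"
    by (rule not_tendsto_subseq) blast
  have bound: "norm (visits \<rho> n (snd d) / real n) \<le> 1" for n and d :: "'v \<times> 'v"
    using visits_le[of \<rho> n "snd d"] by (cases "n = 0") simp_all
  obtain k where k: "strict_mono (k :: nat \<Rightarrow> nat)"
    "\<And>d. d \<in> tedges T \<Longrightarrow> \<exists>t. (\<lambda>n. visits \<rho> (r (k n)) (snd d) / real (r (k n))) \<longlonglongrightarrow> t"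
    by (rule function_convergent_subsequence[OF countable_edges,
          of "\<lambda>n d. visits \<rho> (r n) (snd d) / real (r n)" 1]) (use bound in auto)
  define s where "s = r \<circ> k"
  have s: "strict_mono s" unfolding s_def using r(1) k(1) by (rule strict_mono_o)
  obtain \<theta> where \<theta>: "\<And>d. d \<in> tedges T \<Longrightarrow> (\<lambda>n. visits \<rho> (s n) (snd d) / real (s n)) \<longlonglongrightarrow> \<theta> d"
    using k(2) unfolding s_def o_def by metis
  have "\<theta> e = \<eta> e" by (rule visits_subseq_limit[OF fd cf up s \<theta> e])
  then have "(\<lambda>n. visits \<rho> (s n) (snd e) / real (s n)) \<longlonglongrightarrow> \<eta> e" using \<theta>[OF e] by simp
  then obtain n where "dist (visits \<rho> (s n) (snd e) / real (s n)) (\<eta> e) < \<epsilon>"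
    using r(2) by (auto simp: lim_sequentially)
  then show False using r(3)[of "k n"] by (simp add: s_def)
qed

lemma seq_factorial_limit:
  assumes fd: "factorial_determining T l \<rho>" and cf: "unit_current_flow T l \<eta>"
    and up: "\<And>k. seq_factorial \<rho> k \<le> real k * energy T l \<eta>"
  shows "(\<lambda>n. seq_factorial \<rho> n / real n) \<longlonglongrightarrow> energy T l \<eta>"
proof (rule linear_growth_from_sums[OF seq_factorial_mono[OF fd] energy_nonneg up])
  define W where "W = energy T l \<eta>"
  fix \<epsilon> :: real assume \<epsilon>: "0 < \<epsilon>"
  have sum: "(\<lambda>e. l e * (\<eta> e)\<^sup>2) summable_on tedges T"
    using cf by (simp add: unit_current_flow_def finite_energy_def)
  have "\<exists>F. finite F \<and> F \<subseteq> tedges T \<and> W - \<epsilon> < (\<Sum>e\<in>F. l e * (\<eta> e)\<^sup>2)"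
  proof (rule ccontr)
    assume no: "\<not> ?thesis"
    have "(\<Sum>e\<in>F. l e * (\<eta> e)\<^sup>2) \<le> W - \<epsilon>" if "finite F" "F \<subseteq> tedges T" for F
      using no that by (meson not_le)
    then have "energy T l \<eta> \<le> W - \<epsilon>"
      unfolding energy_def[of T l \<eta>] by (intro infsum_le_finite_sums[OF sum]) auto
    then show False using \<epsilon> by (simp add: W_def)
  qed
  then obtain F where F: "finite F" "F \<subseteq> tedges T" "W - \<epsilon> < (\<Sum>e\<in>F. l e * (\<eta> e)\<^sup>2)" by blast
  have "(\<lambda>n. \<Sum>e\<in>F. l e * ((visits \<rho> n (snd e) / real n) * (visits \<rho> n (snd e) / real n - 1 / real n)))
      \<longlonglongrightarrow> (\<Sum>e\<in>F. l e * (\<eta> e * (\<eta> e - 0)))"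
    by (intro tendsto_sum tendsto_mult tendsto_const tendsto_diff visits_limit[OF fd cf up] lim_1_over_n)
      (use F in auto)
  then have "\<forall>\<^sub>F n in sequentially. W - \<epsilon> <
      (\<Sum>e\<in>F. l e * ((visits \<rho> n (snd e) / real n) * (visits \<rho> n (snd e) / real n - 1 / real n)))"
    by (rule order_tendstoD) (use F(3) in \<open>simp add: power2_eq_square\<close>)
  then show "\<forall>\<^sub>F n in sequentially. (energy T l \<eta> - \<epsilon>) * (real n)\<^sup>2 / 2 \<le> (\<Sum>k<n. seq_factorial \<rho> k)"
    using eventually_gt_at_top[of 0]
  proof eventually_elim
    case (elim n)
    have "(energy T l \<eta> - \<epsilon>) * (real n)\<^sup>2 / 2 \<le> (\<Sum>e\<in>F. l e * ((visits \<rho> n (snd e) / real n) *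
        (visits \<rho> n (snd e) / real n - 1 / real n))) * ((real n)\<^sup>2 / 2)"
      using elim(1) mult_right_mono[of "W - \<epsilon>" _ "(real n)\<^sup>2 / 2"] by (simp add: W_def)
    also have "\<dots> = (\<Sum>e\<in>F. l e * (real (visits \<rho> n (snd e)) * (real (visits \<rho> n (snd e)) - 1) / 2))"
      unfolding sum_distrib_right using elim(2)
      by (intro sum.cong refl) (simp add: power2_eq_square field_simps)
    also have "\<dots> \<le> (\<Sum>k<n. seq_factorial \<rho> k)" by (rule sum_seq_factorial_ge[OF fd F(1,2)])
    finally show ?case .
  qed
qed

end

section \<open>Weak convergence of the empirical measures\<close>

text \<open>Seen as the image of the uniform distribution on \<open>{..<n}\<close>, the set function
  is visibly a measure, so \<open>measure_of\<close> does not fall back to its default. The premise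
  \<open>0 < n\<close> makes that distribution well defined.\<close>

lemma empirical_measure_eq_distr:
  assumes \<rho>: "\<And>j. \<rho> j \<in> topspace X" and n: "0 < n"
  shows "empirical_measure X \<rho> n = distr (measure_pmf (pmf_of_set {..<n})) (borel_of_top X) \<rho>"
    (is "_ = ?D")
proof -
  let ?B = "borel_of_top X"
  have meas: "\<rho> \<in> measurable (measure_pmf (pmf_of_set {..<n})) ?B"
    using \<rho> by (simp add: space_borel_of_top)
  have eq: "(\<Sum>j<n. emeasure (return ?B (\<rho> j)) A) / of_nat n = emeasure ?D A" if A: "A \<in> sets ?B" for A
  proof -
    have "(\<Sum>j<n. emeasure (return ?B (\<rho> j)) A) = (\<Sum>j<n. indicator A (\<rho> j))"
      using A by simp
    also have "\<dots> = of_nat (card ({..<n} \<inter> \<rho> -` A))" by (simp add: indicator_def vimage_def)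
    finally have 1: "(\<Sum>j<n. emeasure (return ?B (\<rho> j)) A) / of_nat n = of_nat (card ({..<n} \<inter> \<rho> -` A)) / of_nat n"
      by simp
    have ne: "{..<n} \<noteq> {}" using n by auto
    have "emeasure ?D A = emeasure (measure_pmf (pmf_of_set {..<n})) (\<rho> -` A)"
      using meas A by (simp add: emeasure_distr)
    also have "\<dots> = ennreal (real (card ({..<n} \<inter> \<rho> -` A)) / real n)"
      using ne by (simp add: emeasure_pmf_of_set)
    also have "\<dots> = of_nat (card ({..<n} \<inter> \<rho> -` A)) / of_nat n"
      using n by (simp add: divide_ennreal[symmetric] ennreal_of_nat_eq_real_of_nat)
    finally show ?thesis using 1 by simp
  qed
  have "empirical_measure X \<rho> n = measure_of (space ?B) (sets ?B) (emeasure ?D)"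
    unfolding empirical_measure_def space_borel_of_top[symmetric]
  proof (rule measure_of_eq)
    show "sets ?B \<subseteq> Pow (space ?B)" by (rule sets.space_closed)
    fix A assume "A \<in> sigma_sets (space ?B) (sets ?B)"
    then show "(\<Sum>j<n. emeasure (return ?B (\<rho> j)) A) / of_nat n = emeasure ?D A"
      unfolding sets.sigma_sets_eq by (rule eq)
  qed
  also have "\<dots> = measure_of (space ?D) (sets ?D) (emeasure ?D)" by simp
  also have "\<dots> = ?D" by (rule measure_of_of_measure)
  finally show ?thesis .
qed

lemma integral_empirical_measure:
  fixes f :: "'a \<Rightarrow> real"
  assumes \<rho>: "\<And>j. \<rho> j \<in> topspace X" and n: "0 < n" and f: "f \<in> borel_measurable (borel_of_top X)"
  shows "(\<integral>x. f x \<partial>empirical_measure X \<rho> n) = (\<Sum>j<n. f (\<rho> j)) / real n"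
proof -
  have ne: "{..<n} \<noteq> {}" using n by auto
  have "(\<integral>x. f x \<partial>empirical_measure X \<rho> n) = (\<integral>j. f (\<rho> j) \<partial>measure_pmf (pmf_of_set {..<n}))"
    unfolding empirical_measure_eq_distr[OF \<rho> n] using \<rho> f
    by (intro integral_distr) (simp_all add: space_borel_of_top)
  then show ?thesis using ne by (simp add: integral_pmf_of_set)
qed

context tree_network
begin

lemma visits_measure_limit:
  assumes fd: "factorial_determining T l \<rho>" and hm: "harmonic_measure T \<eta> \<mu>"
    and lim: "\<And>e. e \<in> tedges T \<Longrightarrow> (\<lambda>n. visits \<rho> n (snd e) / real n) \<longlonglongrightarrow> \<eta> e"
    and v: "v \<in> tverts T"
  shows "(\<lambda>n. visits \<rho> n v / real n) \<longlonglongrightarrow> measure \<mu> (through T v \<inter> boundary T)"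
proof (cases "v = troot T")
  case True
  interpret prob_space \<mu> by (rule harmonic_measureD(1)[OF hm])
  have "through T v \<inter> boundary T = space \<mu>"
    using True harmonic_measureD(2)[OF hm] by (auto simp: through_root ext_boundary_def)
  then have "measure \<mu> (through T v \<inter> boundary T) = 1" using prob_space by simp
  moreover have "\<forall>\<^sub>F n in sequentially. visits \<rho> n v / real n = 1"
    using eventually_gt_at_top[of 0] by eventually_elim (simp add: True visits_root[OF fd])
  ultimately show ?thesis by (simp add: tendsto_eventually)
next
  case False
  then obtain u where "(u, v) \<in> tedges T" using parent_exists[OF v] by auto
  then show ?thesis using lim[of "(u, v)"] harmonic_measureD(4)[OF hm] by simp
qed

text \<open>
  A continuous function is uniformly close to a step function: otherwise this fails below some
  child of every vertex where it fails, which produces a ray on which the function oscillates.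
\<close>

lemma equidistributed_if_visits_limit:
  assumes fd: "factorial_determining T l \<rho>" and hm: "harmonic_measure T \<eta> \<mu>"
    and lim: "\<And>e. e \<in> tedges T \<Longrightarrow> (\<lambda>n. visits \<rho> n (snd e) / real n) \<longlonglongrightarrow> \<eta> e"
  shows "equidistributed T \<rho> \<mu>"
  unfolding equidistributed_def weak_conv_top_def
proof (intro allI impI)
  let ?X = "ext_boundary_topology T"
  let ?B = "borel_of_top ?X"
  note D = factorial_determiningD[OF fd] and H = harmonic_measureD[OF hm]
  interpret prob_space \<mu> by (rule H(1))
  note emb = harmonic_measure_embedding[OF hm]
  have bd: "boundary T \<subseteq> ext_boundary T" by (auto simp: ext_boundary_def)
  fix f :: "'v tpath \<Rightarrow> real"
  assume f: "continuous_map ?X euclideanreal f \<and> bounded (f ` topspace ?X)"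
  have fB: "f \<in> borel_measurable ?B" using f continuous_map_borel_of_top by blast
  have to_mu: "g \<in> borel_measurable \<mu>" if "g \<in> borel_measurable ?B" for g :: "'v tpath \<Rightarrow> real"
    using measurable_compose[OF emb that] .
  have f_int: "integrable \<mu> f"
  proof -
    obtain b where "\<And>x. x \<in> ext_boundary T \<Longrightarrow> norm (f x) \<le> b"
      using f unfolding bounded_iff topspace_ext_boundary by auto
    then show ?thesis
      using H(2) bd to_mu[OF fB] by (intro integrable_const_bound[of _ b]) (auto intro!: AE_I2)
  qed
  have near: "\<forall>\<^sub>F n in sequentially. dist ((\<Sum>j<n. f (\<rho> j)) / real n) (\<integral>x. f x \<partial>\<mu>) < e"
    if e: "0 < e" for e
  proof -
    \<comment> \<open>Three errors of at most \<open>\<epsilon>\<close> occur: replacing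
      \<open>f\<close> by \<open>g\<close> in the average, convergence of the averages of
      \<open>g\<close>, and replacing \<open>g\<close> by \<open>f\<close> in the integral.\<close>
    define \<epsilon> where "\<epsilon> = e / 4"
    have \<epsilon>: "0 < \<epsilon>" using e by (simp add: \<epsilon>_def)
    \<comment> \<open>\<open>Q v\<close> carries the convergence of averages along with the
      approximation. Vanishing off \<open>through T v\<close> allows approximants for different
      children to be added.\<close>
    define Q where "Q v \<longleftrightarrow> (\<exists>g. integrable \<mu> g \<and> (\<forall>\<sigma>\<in>ext_boundary T - through T v. g \<sigma> = 0) \<and>
      (\<forall>\<sigma>\<in>through T v. \<bar>f \<sigma> - g \<sigma>\<bar> \<le> \<epsilon>) \<and>
      (\<lambda>n. (\<Sum>j<n. g (\<rho> j)) / real n) \<longlonglongrightarrow> (\<integral>x. g x \<partial>\<mu>))" for v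
    have Q_flat: "Q v" if v: "v \<in> tverts T" and flat: "\<And>\<sigma>. \<sigma> \<in> through T v \<Longrightarrow> \<bar>f \<sigma> - c\<bar> \<le> \<epsilon>" for v c
    proof -
      define g where "g \<sigma> = c * indicator (through T v) \<sigma>" for \<sigma> :: "'v tpath"
      have eq: "indicator (through T v) x = (indicator (through T v \<inter> boundary T) x :: real)" if "x \<in> space \<mu>" for x
        using that H(2) by (simp add: indicator_def)
      have "integrable \<mu> (\<lambda>x. c * (indicator (through T v \<inter> boundary T) x :: real))"
        using H(3)[OF v] by (intro integrable_mult_right) (simp add: emeasure_eq_measure)
      then have int: "integrable \<mu> g"
        unfolding g_def using eq by (subst Bochner_Integration.integrable_cong[OF refl]) auto
      have "(\<integral>x. g x \<partial>\<mu>) = (\<integral>x. c * indicator (through T v \<inter> boundary T) x \<partial>\<mu>)"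
        unfolding g_def using eq by (intro Bochner_Integration.integral_cong) auto
      also have "\<dots> = c * measure \<mu> (through T v \<inter> boundary T)"
        using H(3)[OF v] H(2) by (simp add: Int_absorb2 Int_absorb1)
      finally have ig: "(\<integral>x. g x \<partial>\<mu>) = c * measure \<mu> (through T v \<inter> boundary T)" .
      have avg: "(\<Sum>j<n. g (\<rho> j)) / real n = c * (visits \<rho> n v / real n)" for n
        unfolding visits_sum g_def sum_distrib_left[symmetric]
        using D(1) by (simp add: indicator_def through_iff of_bool_def)
      show ?thesis
        unfolding Q_def
      proof (intro exI[of _ g] conjI ballI int)
        show "(\<lambda>n. (\<Sum>j<n. g (\<rho> j)) / real n) \<longlonglongrightarrow> (\<integral>x. g x \<partial>\<mu>)"
          unfolding ig avg by (rule tendsto_mult_left[OF visits_measure_limit[OF fd hm lim v]])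
      qed (use flat in \<open>auto simp: g_def\<close>)
    qed
    have Q_step: "Q v" if v: "v \<in> tverts T" and ch: "\<And>w. (v, w) \<in> tedges T \<Longrightarrow> Q w" for v
    proof (cases "children T v = {}")
      case True
      obtain \<sigma> where \<sigma>: "\<sigma> \<in> through T v" using through_nonempty[OF v] by auto
      then have "\<tau> = \<sigma>" if "\<tau> \<in> through T v" for \<tau> using through_leaf_unique[OF True that] by blast
      then show ?thesis using Q_flat[OF v, of "f \<sigma>"] \<epsilon> by fastforce
    next
      case False
      note fin = finite_children[OF v]
      have "\<forall>w\<in>children T v. \<exists>g. integrable \<mu> g \<and> (\<forall>\<sigma>\<in>ext_boundary T - through T w. g \<sigma> = 0) \<and>
        (\<forall>\<sigma>\<in>through T w. \<bar>f \<sigma> - g \<sigma>\<bar> \<le> \<epsilon>) \<and>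
        (\<lambda>n. (\<Sum>j<n. g (\<rho> j)) / real n) \<longlonglongrightarrow> (\<integral>x. g x \<partial>\<mu>)"
        using ch unfolding Q_def by simp
      then obtain G where G: "\<And>w. w \<in> children T v \<Longrightarrow> integrable \<mu> (G w)"
        "\<And>w \<sigma>. w \<in> children T v \<Longrightarrow> \<sigma> \<in> ext_boundary T - through T w \<Longrightarrow> G w \<sigma> = 0"
        "\<And>w \<sigma>. w \<in> children T v \<Longrightarrow> \<sigma> \<in> through T w \<Longrightarrow> \<bar>f \<sigma> - G w \<sigma>\<bar> \<le> \<epsilon>"
        "\<And>w. w \<in> children T v \<Longrightarrow> (\<lambda>n. (\<Sum>j<n. G w (\<rho> j)) / real n) \<longlonglongrightarrow> (\<integral>x. G w x \<partial>\<mu>)"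
        by (subst (asm) bchoice_iff) blast
      define g where "g \<sigma> = (\<Sum>w\<in>children T v. G w \<sigma>)" for \<sigma>
      have int: "integrable \<mu> g" unfolding g_def using G(1) by (rule Bochner_Integration.integrable_sum)
      have zero: "g \<sigma> = 0" if "\<sigma> \<in> ext_boundary T - through T v" for \<sigma>
        unfolding g_def
      proof (rule sum.neutral, rule ballI)
        fix w assume w: "w \<in> children T v"
        then have "\<sigma> \<notin> through T w" using that through_children[OF False] by auto
        then show "G w \<sigma> = 0" using G(2)[OF w] that by simp
      qed
      have close: "\<bar>f \<sigma> - g \<sigma>\<bar> \<le> \<epsilon>" if \<sigma>: "\<sigma> \<in> through T v" for \<sigma>
      proof -
        obtain w where w: "w \<in> children T v" "\<sigma> \<in> through T w" using \<sigma> through_children[OF False] by auto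
        have "g \<sigma> = G w \<sigma> + (\<Sum>x\<in>children T v - {w}. G x \<sigma>)"
          unfolding g_def by (rule sum.remove[OF fin w(1)])
        also have "(\<Sum>x\<in>children T v - {w}. G x \<sigma>) = 0"
        proof (rule sum.neutral, rule ballI)
          fix x assume x: "x \<in> children T v - {w}"
          then have "\<sigma> \<notin> through T x" using through_disjoint[of v x w] w by auto
          then show "G x \<sigma> = 0" using G(2)[of x \<sigma>] x \<sigma> by (simp add: through_iff)
        qed
        finally show ?thesis using G(3)[OF w] by simp
      qed
      have "(\<lambda>n. \<Sum>w\<in>children T v. (\<Sum>j<n. G w (\<rho> j)) / real n) \<longlonglongrightarrow> (\<Sum>w\<in>children T v. \<integral>x. G w x \<partial>\<mu>)"
        by (rule tendsto_sum) (rule G(4))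
      moreover have "(\<Sum>w\<in>children T v. (\<Sum>j<n. G w (\<rho> j)) / real n) = (\<Sum>j<n. g (\<rho> j)) / real n" for n
        unfolding g_def sum_divide_distrib[symmetric] by (subst sum.swap) (rule refl)
      moreover have "(\<Sum>w\<in>children T v. \<integral>x. G w x \<partial>\<mu>) = (\<integral>x. g x \<partial>\<mu>)"
        unfolding g_def using G(1) by (rule Bochner_Integration.integral_sum[symmetric])
      ultimately show ?thesis unfolding Q_def using int zero close by (intro exI[of _ g]) simp
    qed
    have "Q (troot T)"
    proof (rule ccontr)
      assume notQ: "\<not> Q (troot T)"
      have "\<exists>h. \<forall>n. ((h n \<in> tverts T \<and> \<not> Q (h n)) \<and> (n = 0 \<longrightarrow> h n = troot T)) \<and> (h n, h (Suc n)) \<in> tedges T"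
      proof (rule dependent_nat_choice)
        show "\<exists>v. (v \<in> tverts T \<and> \<not> Q v) \<and> ((0::nat) = 0 \<longrightarrow> v = troot T)"
          using notQ root_vert by blast
        fix v and n :: nat assume "(v \<in> tverts T \<and> \<not> Q v) \<and> (n = 0 \<longrightarrow> v = troot T)"
        then obtain w where "(v, w) \<in> tedges T" "\<not> Q w" using Q_step by blast
        then show "\<exists>w. ((w \<in> tverts T \<and> \<not> Q w) \<and> (Suc n = 0 \<longrightarrow> w = troot T)) \<and> (v, w) \<in> tedges T"
          using edge_verts by blast
      qed
      then obtain h where h: "\<And>n. \<not> Q (h n)" "h 0 = troot T" "\<And>n. (h n, h (Suc n)) \<in> tedges T" by blast
      define \<sigma> where "\<sigma> = InfPath h"
      have \<sigma>: "\<sigma> \<in> ext_boundary T" using h(2,3) by (auto simp: \<sigma>_def ext_boundary_def boundary_def)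
      \<comment> \<open>Continuity at \<open>\<sigma>\<close> supplies a vertex of the ray below
        which \<open>f\<close> is within \<open>\<epsilon>\<close> of \<open>f \<sigma>\<close>, so
        \<open>Q\<close> holds there with a constant approximant.\<close>
      define U where "U = {x \<in> topspace ?X. f x \<in> ball (f \<sigma>) \<epsilon>}"
      have "openin ?X U"
        unfolding U_def using f by (intro openin_continuous_map_preimage[of ?X euclideanreal f]) auto
      moreover have "\<sigma> \<in> U" using \<sigma> \<epsilon> by (simp add: U_def topspace_ext_boundary)
      ultimately obtain v where v: "v \<in> path_verts \<sigma>" "through T v \<subseteq> U"
        using openin_contains_through[OF _ \<sigma>] by blast
      have "v \<in> tverts T" using v(1) path_verts_subset[OF \<sigma>] by blast
      moreover have "\<bar>f \<tau> - f \<sigma>\<bar> \<le> \<epsilon>" if "\<tau> \<in> through T v" for \<tau>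
        using v(2) that by (auto simp: U_def dist_real_def)
      ultimately have "Q v" by (rule Q_flat)
      then show False using v(1) h(1) by (auto simp: \<sigma>_def)
    qed
    then obtain g where g: "integrable \<mu> g" "\<And>\<sigma>. \<sigma> \<in> ext_boundary T \<Longrightarrow> \<bar>f \<sigma> - g \<sigma>\<bar> \<le> \<epsilon>"
      "(\<lambda>n. (\<Sum>j<n. g (\<rho> j)) / real n) \<longlonglongrightarrow> (\<integral>x. g x \<partial>\<mu>)"
      unfolding Q_def through_root by blast
    have "\<bar>(\<integral>x. f x \<partial>\<mu>) - (\<integral>x. g x \<partial>\<mu>)\<bar> = \<bar>\<integral>x. f x - g x \<partial>\<mu>\<bar>"
      using f_int g(1) by simp
    also have "\<dots> \<le> (\<integral>x. \<bar>f x - g x\<bar> \<partial>\<mu>)" by (rule integral_abs_bound)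
    also have "\<dots> \<le> (\<integral>x. \<epsilon> \<partial>\<mu>)"
      using f_int g(1) g(2) bd H(2) by (intro integral_mono) auto
    also have "\<dots> = \<epsilon>" by (simp add: prob_space)
    finally have 1: "\<bar>(\<integral>x. f x \<partial>\<mu>) - (\<integral>x. g x \<partial>\<mu>)\<bar> \<le> \<epsilon>" .
    have 2: "\<bar>(\<Sum>j<n. f (\<rho> j)) / real n - (\<Sum>j<n. g (\<rho> j)) / real n\<bar> \<le> \<epsilon>" if "0 < n" for n
    proof -
      have "\<bar>\<Sum>j<n. f (\<rho> j) - g (\<rho> j)\<bar> \<le> (\<Sum>j<n. \<epsilon>)"
        by (rule order_trans[OF sum_abs]) (intro sum_mono g(2) D(1))
      then show ?thesis
        using that by (simp add: sum_subtractf diff_divide_distrib[symmetric] divide_le_eq mult.commute)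
    qed
    have "\<forall>\<^sub>F n in sequentially. dist ((\<Sum>j<n. g (\<rho> j)) / real n) (\<integral>x. g x \<partial>\<mu>) < \<epsilon>"
      using tendstoD[OF g(3) \<epsilon>] .
    then show ?thesis
      using eventually_gt_at_top[of 0]
    proof eventually_elim
      case (elim n)
      then show ?case using 1 2[of n] \<epsilon> unfolding dist_real_def \<epsilon>_def by linarith
    qed
  qed
  have "(\<lambda>n. (\<Sum>j<n. f (\<rho> j)) / real n) \<longlonglongrightarrow> (\<integral>x. f x \<partial>\<mu>)"
    using near by (rule tendstoI)
  moreover have "\<forall>\<^sub>F n in sequentially.
      (\<Sum>j<n. f (\<rho> j)) / real n = (\<integral>x. f x \<partial>empirical_measure ?X \<rho> n)"
    using eventually_gt_at_top[of 0]
    by eventually_elim (simp add: integral_empirical_measure[OF _ _ fB] topspace_ext_boundary D(1))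
  ultimately have "(\<lambda>n. \<integral>x. f x \<partial>empirical_measure ?X \<rho> n) \<longlonglongrightarrow> (\<integral>x. f x \<partial>\<mu>)"
    by (rule Lim_transform_eventually)
  moreover have "(\<integral>x. f x \<partial>extend_measure_boundary T \<mu>) = (\<integral>x. f x \<partial>\<mu>)"
    unfolding extend_measure_boundary_def by (rule integral_distr[OF emb fB])
  ultimately show "(\<lambda>n. \<integral>x. f x \<partial>empirical_measure ?X \<rho> n) \<longlonglongrightarrow> (\<integral>x. f x \<partial>extend_measure_boundary T \<mu>)"
    by simp
qed

end

theorem theorem1p7:
  fixes T :: "'v rooted_graph" and l \<eta> :: "'v \<times> 'v \<Rightarrow> real" and \<mu> :: "'v tpath measure"
  assumes "rooted_tree T"
    and "tree_locally_finite T"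
    and "length_function T l"
    and "random_walk_transient T l"
    and "unit_current_flow T l \<eta>"
    and "harmonic_measure T \<eta> \<mu>"
    and "weakly_complete T l"
  shows "(\<forall>\<rho>. factorial_determining T l \<rho> \<longrightarrow> equidistributed T \<rho> \<mu>) \<and>
    convergent (\<lambda>n. tree_factorial T l n / real n) \<and>
    tree_H T l = energy T l \<eta>"
proof -
  have flow: "unit_flow T \<eta>" "finite_energy T l \<eta>"
    using assms(5) by (auto simp: unit_current_flow_def)
  \<comment> \<open>An empty sum at the root could not equal 1.\<close>
  have "children T (troot T) \<noteq> {}"
    using flow(1) by (auto simp: unit_flow_def)
  then interpret tree_network T l
    by unfold_locales (use assms in auto)
  have up: "seq_factorial \<rho> k \<le> real k * energy T l \<eta>" if "factorial_determining T l \<rho>" for \<rho> k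
    by (rule seq_factorial_le[OF that assms(7,5,6)])
  \<comment> \<open>\<open>tree_factorial\<close> refers to this chosen sequence, so existence is
    needed before anything is known about it.\<close>
  define \<rho> where "\<rho> = (SOME \<rho>. factorial_determining T l \<rho>)"
  have fd: "factorial_determining T l \<rho>"
    unfolding \<rho>_def
    by (rule someI_ex[of "factorial_determining T l"])
      (rule factorial_determining_exists[OF infinite_ext_boundary[OF flow assms(7)]])
  have "tree_factorial T l n = seq_factorial \<rho> n" for n
    by (simp add: tree_factorial_def seq_factorial_def \<rho>_def Let_def)
  then have lim: "(\<lambda>n. tree_factorial T l n / real n) \<longlonglongrightarrow> energy T l \<eta>"
    using seq_factorial_limit[OF fd assms(5) up[OF fd]] by simp
  have "equidistributed T \<rho>' \<mu>" if "factorial_determining T l \<rho>'" for \<rho>'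
    by (rule equidistributed_if_visits_limit[OF that assms(6)])
      (rule visits_limit[OF that assms(5) up[OF that]])
  then show ?thesis
    using lim by (auto simp: tree_H_def convergent_def limI)
qed

end
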